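(* Let $\mathcal G=([m],E)$ be a directed tree with the constant coloring $c^*$. Then: (1) The minimal linear subspace containing $\mathcal V_{\hat\varphi}$ is the zero locus of the following: (a) $z_S-z_{S'}$, when $\bigwedge_{(i,j)\in S}t(i,j)=\bigwedge_{(i,j)\in S'}t(i,j)$; (b) $z_S-z_{S_1}-z_{S_2}+z_{S_3}$, where $s=\bigwedge_{(i,j)\in S}t(i,j)$ satisfies $r(s)=0$, the elements $s_1=\bigwedge_{(i,j)\in S_1}t(i,j)$ and $s_2=\bigwedge_{(i,j)\in S_2}t(i,j)$ are the lower cover of $s$ in $P_{\mathcal G}$, and $s_1\wedge s_2=\bigwedge_{(i,j)\in S_3}t(i,j)$. (2) $\mathrm{rank}(M_{\varphi})=\mathrm{rank}(M_{\hat\varphi})$. (3) $\dim\ker(M_{\varphi}^t)=\binom{m+1}{2}-2h(\mathcal G)-1$.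
   Context: A directed tree $\mathcal G=([m],E)$ is a directed acyclic graph on $[m]=\{1,\dots,m\}$ whose underlying undirected graph is a tree and which has a unique source node. $h(\mathcal G)$ is the length of the longest directed path in $\mathcal G$. A trek between $i$ and $j$ is a pair $T=\{P,Q\}$ of directed paths (length zero allowed) with a common starting node, $P$ ending at $i$ and $Q$ ending at $j$; its length is $|T|=|P|+|Q|$ (number of edges). Let $N$ be the length of the longest trek in $\mathcal G$. Under the constant coloring $c^*$ all vertices share one parameter $\omega$ and all edges share one parameter $\lambda$, and the trek polynomial is $p_{i,j}=\sum_T\omega\lambda^{|T|}$, summed over all treks $T$ between $i$ and $j$. Its coefficient vector is $t(i,j)\in\mathbb Z_{\ge0}^{\{0,\dots,N\}}$, whose $k$-th entry is the number of treks between $i$ and $j$ of length $k$ (the coefficient of $\omega\lambda^k$). Let $\mathfrak I=\{(i,j):1\le i\le j\le m\}$. $P_{\mathcal G}$ is the poset of all coordinatewise minima $\bigwedge_{(i,j)\in S}t(i,j)$, $\emptyset\ne S\subseteq\mathfrak I$, under the coordinatewise order $\preceq$; $\wedge,\vee$ denote coordinatewise minimum and maximum. The lower cover of $s$ is the set of elements covered by $s$. The residue vector of $s\in P_{\mathcal G}$ is $r(s)=s-\bigvee_{s'\prec s}s'$ (empty join $=0$). $M_\varphi$ is the matrix with rows $t(i,j)$, $(i,j)\in\mathfrak I$; $M_{\hat\varphi}$ is the matrix with rows $\bigwedge_{(i,j)\in S}t(i,j)$, one for each nonempty $S\subseteq\mathfrak I$. The map $\hat\varphi$ sends $(\omega,\lambda)\in\mathbb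 R^2$ to the point with coordinates $(z_S)_{\emptyset\ne S\subseteq\mathfrak I}$, $\hat\varphi(\omega,\lambda)=M_{\hat\varphi}\,(\omega,\omega\lambda,\dots,\omega\lambda^N)^t$, and $\mathcal V_{\hat\varphi}$ is the Zariski closure of its image.
   Formalization: In (1) the relations z_S = 0 for all S whose meet is the zero vector are added to (a) and (b); without them the claim fails for every m ≥ 2, since the all-ones vector satisfies (a) and (b) but z_S vanishes on the variety for such S. *)

theory Defs
  imports
    "Jordan_Normal_Form.Matrix_Kernel"
    "Jordan_Normal_Form.DL_Rank"
begin

definition undirected_cycle :: "(nat \<times> nat) set \<Rightarrow> nat list \<Rightarrow> bool" where
  "undirected_cycle E p \<longleftrightarrow> 3 \<le> length p \<and> distinct p \<and>
     successively (\<lambda>u v. (u, v) \<in> E \<union> E\<inverse>) p \<and> (last p, hd p) \<in> E \<union> E\<inverse>"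

definition underlying_tree :: "nat \<Rightarrow> (nat \<times> nat) set \<Rightarrow> bool" where
  "underlying_tree m E \<longleftrightarrow>
     (\<forall>u \<in> {1..m}. \<forall>v \<in> {1..m}. (u, v) \<in> (E \<union> E\<inverse>)\<^sup>*) \<and> (\<nexists>p. undirected_cycle E p)"

definition directed_tree :: "nat \<Rightarrow> (nat \<times> nat) set \<Rightarrow> bool" where
  "directed_tree m E \<longleftrightarrow> E \<subseteq> {1..m} \<times> {1..m} \<and> acyclic E \<and> underlying_tree m E \<and>
     (\<exists>!r. r \<in> {1..m} \<and> (\<forall>u. (u, r) \<notin> E))"

text \<open>A directed path is given by its nonempty list of vertices; its length is the number of edges.\<close>

definition directed_path :: "nat \<Rightarrow> (nat \<times> nat) set \<Rightarrow> nat list \<Rightarrow> bool" where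
  "directed_path m E p \<longleftrightarrow> p \<noteq> [] \<and> set p \<subseteq> {1..m} \<and> successively (\<lambda>u v. (u, v) \<in> E) p"

definition path_length :: "nat list \<Rightarrow> nat" where
  "path_length p = length p - 1"

definition height :: "nat \<Rightarrow> (nat \<times> nat) set \<Rightarrow> nat" where
  "height m E = Max {path_length p | p. directed_path m E p}"

text \<open>A trek is encoded as the pair (P, Q) with P ending at i and Q ending at j. For i = j this counts
  the same objects as unordered pairs: in a directed tree there is at most one directed path between
  two vertices, so then P = Q.\<close>

definition treks :: "nat \<Rightarrow> (nat \<times> nat) set \<Rightarrow> nat \<Rightarrow> nat \<Rightarrow> (nat list \<times> nat list) set" where
  "treks m E i j = {(P, Q). directed_path m E P \<and> directed_path m E Q \<and> hd P = hd Q \<and>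
     last P = i \<and> last Q = j}"

definition trek_length :: "nat list \<times> nat list \<Rightarrow> nat" where
  "trek_length T = path_length (fst T) + path_length (snd T)"

definition max_trek_length :: "nat \<Rightarrow> (nat \<times> nat) set \<Rightarrow> nat" where
  "max_trek_length m E = Max {trek_length T | T i j. T \<in> treks m E i j}"

text \<open>The coefficient vector of the trek polynomial of the constant coloring: the coefficient of
  \<omega> * \<lambda>^k is the number of treks of length k.\<close>

definition trek_vec :: "nat \<Rightarrow> (nat \<times> nat) set \<Rightarrow> nat \<times> nat \<Rightarrow> int vec" where
  "trek_vec m E = (\<lambda>(i, j). vec (max_trek_length m E + 1)
     (\<lambda>k. int (card {T \<in> treks m E i j. trek_length T = k})))"

definition index_pairs :: "nat \<Rightarrow> (nat \<times> nat) set" where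
  "index_pairs m = {(i, j). 1 \<le> i \<and> i \<le> j \<and> j \<le> m}"

definition index_sets :: "nat \<Rightarrow> (nat \<times> nat) set set" where
  "index_sets m = {S. S \<noteq> {} \<and> S \<subseteq> index_pairs m}"

definition vec_Min :: "nat \<Rightarrow> int vec set \<Rightarrow> int vec" where
  "vec_Min n A = vec n (\<lambda>k. Min ((\<lambda>v. v $ k) ` A))"

definition vec_Max :: "nat \<Rightarrow> int vec set \<Rightarrow> int vec" where
  "vec_Max n A = (if A = {} then 0\<^sub>v n else vec n (\<lambda>k. Max ((\<lambda>v. v $ k) ` A)))"

definition trek_meet :: "nat \<Rightarrow> (nat \<times> nat) set \<Rightarrow> (nat \<times> nat) set \<Rightarrow> int vec" where
  "trek_meet m E S = vec_Min (max_trek_length m E + 1) (trek_vec m E ` S)"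

text \<open>The order on \<^typ>\<open>int vec\<close> is the coordinatewise one.\<close>

definition trek_poset :: "nat \<Rightarrow> (nat \<times> nat) set \<Rightarrow> int vec set" where
  "trek_poset m E = trek_meet m E ` index_sets m"

definition lower_cover :: "nat \<Rightarrow> (nat \<times> nat) set \<Rightarrow> int vec \<Rightarrow> int vec set" where
  "lower_cover m E s =
     {s' \<in> trek_poset m E. s' < s \<and> \<not> (\<exists>u \<in> trek_poset m E. s' < u \<and> u < s)}"

definition residue_vec :: "nat \<Rightarrow> (nat \<times> nat) set \<Rightarrow> int vec \<Rightarrow> int vec" where
  "residue_vec m E s = s - vec_Max (max_trek_length m E + 1) {s' \<in> trek_poset m E. s' < s}"

text \<open>The rows of the matrices are enumerated by the following duplicate-free lists of the elements
  of \<^term>\<open>index_pairs m\<close> and of \<^term>\<open>index_sets m\<close>.\<close>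

definition pair_list :: "nat \<Rightarrow> (nat \<times> nat) list" where
  "pair_list m = filter (\<lambda>(i, j). i \<le> j) (List.product [1..<Suc m] [1..<Suc m])"

definition set_list :: "nat \<Rightarrow> (nat \<times> nat) set list" where
  "set_list m = filter (\<lambda>S. S \<noteq> {}) (map set (subseqs (pair_list m)))"

lemma pair_list: "distinct (pair_list m)" "set (pair_list m) = index_pairs m"
  unfolding pair_list_def index_pairs_def by (auto intro!: distinct_filter distinct_product)

lemma set_list: "distinct (set_list m)" "set (set_list m) = index_sets m"
proof -
  show "distinct (set_list m)"
    unfolding set_list_def using distinct_set_subseqs[OF pair_list(1)] by simp
  show "set (set_list m) = index_sets m"
    unfolding set_list_def index_sets_def
    using subseqs_powset[of "pair_list m"] pair_list(2)[of m] by auto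
qed

definition M_phi :: "nat \<Rightarrow> (nat \<times> nat) set \<Rightarrow> real mat" where
  "M_phi m E = mat_of_rows (max_trek_length m E + 1)
     (map (\<lambda>a. map_vec of_int (trek_vec m E a)) (pair_list m))"

definition M_phi_hat :: "nat \<Rightarrow> (nat \<times> nat) set \<Rightarrow> real mat" where
  "M_phi_hat m E = mat_of_rows (max_trek_length m E + 1)
     (map (\<lambda>S. map_vec of_int (trek_meet m E S)) (set_list m))"

definition phi_hat :: "nat \<Rightarrow> (nat \<times> nat) set \<Rightarrow> real \<times> real \<Rightarrow> real vec" where
  "phi_hat m E = (\<lambda>(w, l). M_phi_hat m E *\<^sub>v vec (max_trek_length m E + 1) (\<lambda>k. w * l ^ k))"

text \<open>The coordinate z_S of a point z of the ambient space, whose coordinates are indexed by the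
  positions in \<^term>\<open>set_list m\<close>.\<close>

definition coord :: "nat \<Rightarrow> real vec \<Rightarrow> (nat \<times> nat) set \<Rightarrow> real" where
  "coord m z S = z $ (THE a. a < length (set_list m) \<and> set_list m ! a = S)"

inductive_set polynomial_functions :: "nat \<Rightarrow> (real vec \<Rightarrow> real) set" for n :: nat where
  const: "(\<lambda>x. c) \<in> polynomial_functions n"
| coordinate: "i < n \<Longrightarrow> (\<lambda>x. x $ i) \<in> polynomial_functions n"
| add: "p \<in> polynomial_functions n \<Longrightarrow> q \<in> polynomial_functions n \<Longrightarrow>
    (\<lambda>x. p x + q x) \<in> polynomial_functions n"
| mult: "p \<in> polynomial_functions n \<Longrightarrow> q \<in> polynomial_functions n \<Longrightarrow>
    (\<lambda>x. p x * q x) \<in> polynomial_functions n"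

definition zariski_closure :: "nat \<Rightarrow> real vec set \<Rightarrow> real vec set" where
  "zariski_closure n X = {z \<in> carrier_vec n.
     \<forall>p \<in> polynomial_functions n. (\<forall>x \<in> X. p x = 0) \<longrightarrow> p z = 0}"

definition V_phi_hat :: "nat \<Rightarrow> (nat \<times> nat) set \<Rightarrow> real vec set" where
  "V_phi_hat m E = zariski_closure (length (set_list m)) (range (phi_hat m E))"

definition minimal_linear_subspace :: "nat \<Rightarrow> real vec set \<Rightarrow> real vec set \<Rightarrow> bool" where
  "minimal_linear_subspace n X L \<longleftrightarrow>
     subspace class_ring L (module_vec TYPE(real) n) \<and> X \<subseteq> L \<and>
     (\<forall>W. subspace class_ring W (module_vec TYPE(real) n) \<and> X \<subseteq> W \<longrightarrow> L \<subseteq> W)"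

text \<open>The last condition is the degenerate instance of the relation for r(s) = 0 at the zero vector
  s = 0. If 0 lies in the poset (which is the case whenever m > 1), it is the bottom element, its
  residue vector is 0 and its lower cover is empty, so only the term z_S is left; z_S vanishes
  identically on the image of the parametrization. Without it the vector with all coordinates 1
  would satisfy all relations.\<close>

definition relation_locus :: "nat \<Rightarrow> (nat \<times> nat) set \<Rightarrow> real vec set" where
  "relation_locus m E = {z \<in> carrier_vec (length (set_list m)).
     (\<forall>S \<in> index_sets m. \<forall>S' \<in> index_sets m.
        trek_meet m E S = trek_meet m E S' \<longrightarrow> coord m z S - coord m z S' = 0) \<and>
     (\<forall>S \<in> index_sets m. \<forall>S1 \<in> index_sets m. \<forall>S2 \<in> index_sets m. \<forall>S3 \<in> index_sets m.
        residue_vec m E (trek_meet m E S) = 0\<^sub>v (max_trek_length m E + 1) \<and>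
        lower_cover m E (trek_meet m E S) = {trek_meet m E S1, trek_meet m E S2} \<and>
        vec_Min (max_trek_length m E + 1) {trek_meet m E S1, trek_meet m E S2} = trek_meet m E S3 \<longrightarrow>
        coord m z S - coord m z S1 - coord m z S2 + coord m z S3 = 0) \<and>
     (\<forall>S \<in> index_sets m. trek_meet m E S = 0\<^sub>v (max_trek_length m E + 1) \<longrightarrow> coord m z S = 0)}"

end

theory Submission
  imports Defs "HOL-Library.Sublist"
begin

text \<open>
  In a directed tree every vertex has a unique path from the root, so a trek between \<open>i\<close> and \<open>j\<close>
  is a choice of a common ancestor. If \<open>c\<close> is the depth of the lowest one and \<open>e\<close> is the sum of the
  depths of \<open>i\<close> and \<open>j\<close>, then \<open>t(i, j)\<close> is the indicator vector of \<open>{e - 2 c, ..., e - 2, e}\<close>,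
  and the poset consists of intersections of such sets.

  Replacing \<open>i\<close> and \<open>j\<close> by their parents shows that the poset is closed under removing the maximum
  of a set with at least two elements. Hence the residue of a set is \<open>0\<close> or the unit vector at its
  maximum \<open>k\<close>, the latter for at most one set \<open>u\<^sub>k\<close> for each \<open>k\<close>; and if the residue is \<open>0\<close>, the lower
  cover has two elements whose union is the whole set. So a solution \<open>z\<close> of the relations is
  determined by the numbers \<open>x\<^sub>k = z(u\<^sub>k) - z(u\<^sub>k - {k})\<close>, and it is the image of \<open>x\<close>
  under the matrix. Conversely the image is spanned by the points of the parametrization with
  \<open>\<omega> = 1\<close> and \<open>\<lambda> = 0, ..., N\<close>, by Vandermonde.

  Along a longest path from the root every unit vector is a vector \<open>t(i, j)\<close> or a difference of two
  of them, so both matrices have full column rank \<open>N + 1 = 2 h + 1\<close>.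
\<close>

section \<open>Ranks and subspaces\<close>

lemma rank_plus_kernel_dim:
  fixes A :: "'a :: field mat"
  assumes A: "A \<in> carrier_mat nr nc"
  shows "vec_space.rank nr A + kernel_dim A = nc"
proof -
  interpret C: vec_space "TYPE('a)" nc .
  interpret R: vec_space "TYPE('a)" nr .
  have "(*\<^sub>v) A \<in> LinearCombinations.module_hom class_ring C.V R.V"
    using A unfolding LinearCombinations.module_hom_def
    by (auto simp: mult_add_distrib_mat_vec[OF A] mult_mat_vec[OF A])
  then interpret T: linear_map class_ring C.V R.V "(*\<^sub>v) A"
    by unfold_locales
  have 1: "T.kerT = mat_kernel A"
    unfolding T.ker_def mat_kernel[OF A] by auto
  have "T.imT = (*\<^sub>v) A ` carrier_vec nc"
    unfolding T.im_def by simp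
  also have "\<dots> = R.col_space A"
    unfolding R.col_space_eq[OF A] using A by auto
  finally have 2: "T.imT = R.span (set (cols A))"
    unfolding R.col_space_def .
  show ?thesis
    using T.rank_nullity[OF C.fin_dim] A C.dim_is_n 1 2
    unfolding R.rank_def kernel_dim_def by simp
qed
text \<open>The zero space is spanned by the empty set, so the kernel has dimension 0 and
  rank-nullity leaves full column rank. Both matrices of the theorem get their rank this
  way.\<close>

lemma rank_eq_if_kernel_trivial:
  fixes A :: "'a :: field mat"
  assumes A: "A \<in> carrier_mat nr nc"
    and ker: "\<And>v. v \<in> carrier_vec nc \<Longrightarrow> A *\<^sub>v v = 0\<^sub>v nr \<Longrightarrow> v = 0\<^sub>v nc"
  shows "vec_space.rank nr A = nc"
proof -
  interpret kernel nr nc A by unfold_locales (rule A)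
  have k: "mat_kernel A = {0\<^sub>v nc}"
    using ker A by (auto simp: mat_kernel[OF A])
  have g: "Ker.gen_set {}" using k Ker.span_empty by simp
  have d: "dim = 0"
    unfolding Ker.dim_def by (rule Least_eq_0, rule exI[of _ "{}"]) (use g in simp)
  show ?thesis using d rank_plus_kernel_dim[OF A] by simp
qed


lemma rank_eq_if_unit_vecs_in_span:
  fixes A :: "'a :: field mat"
  assumes A: "A \<in> carrier_mat nr nc"
    and unit: "\<And>k. k < nr \<Longrightarrow> unit_vec nr k \<in> vec_space.col_space nr A"
  shows "vec_space.rank nr A = nr"
proof -
  interpret R: vec_space "TYPE('a)" nr .
  have sub: "set (cols A) \<subseteq> carrier_vec nr"
    using A cols_dim by blast
  have "set (unit_vecs nr) \<subseteq> R.span (set (cols A))"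
    using unit unfolding R.col_space_def unit_vecs_def by auto
  from R.span_subsetI[OF sub this] have "carrier_vec nr \<subseteq> R.span (set (cols A))"
    unfolding R.span_unit_vecs_is_carrier .
  moreover have "R.span (set (cols A)) \<subseteq> carrier_vec nr"
    using sub by (rule R.span_is_subset2)
  ultimately have 1: "R.span (set (cols A)) = carrier_vec nr"
    by (intro subset_antisym)
  have 2: "R.vs (carrier_vec nr) = R.V"
    by (simp add: module_vec_def)
  show ?thesis
    unfolding R.rank_def 1 2 by (rule R.dim_is_n)
qed

lemma subspace_vecI:
  assumes "W \<subseteq> carrier_vec n" "0\<^sub>v n \<in> W"
    and "\<And>v w. v \<in> W \<Longrightarrow> w \<in> W \<Longrightarrow> v + w \<in> W"
    and "\<And>c v. v \<in> W \<Longrightarrow> c \<cdot>\<^sub>v v \<in> W"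
  shows "subspace class_ring W (module_vec TYPE('a :: field) n)"
  using assms vec_vs vec_module unfolding subspace_def submodule_def
  by (auto simp: module_vec_simps class_ring_simps)

lemma mult_mat_vec_in_subspace:
  fixes A :: "'a :: field mat"
  assumes W: "subspace class_ring W (module_vec TYPE('a) n)"
    and A: "A \<in> carrier_mat n k"
    and cols: "\<And>j. j < k \<Longrightarrow> col A j \<in> W"
    and x: "x \<in> carrier_vec k"
  shows "A *\<^sub>v x \<in> W"
proof -
  interpret R: vec_space "TYPE('a)" n .
  have "A *\<^sub>v x \<in> R.col_space A"
    unfolding R.col_space_eq[OF A] using A x by auto
  moreover have "R.span (set (cols A)) \<subseteq> W"
    using W A cols by (intro R.span_is_subset) (auto simp: subspace_def cols_def)
  ultimately show ?thesis unfolding R.col_space_def by auto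
qed

text \<open>A vector in the kernel of the transpose is the coefficient list of a polynomial of
  degree below \<open>n\<close> that vanishes at the \<open>n\<close> points
  \<open>0, ..., n - 1\<close>, hence it is zero. So the determinant is nonzero and \<open>y\<close>
  is the inverse matrix applied to \<open>x\<close>.\<close>

lemma vandermonde_surjective:
  fixes x :: "real vec"
  assumes x: "x \<in> carrier_vec n"
  shows "\<exists>y \<in> carrier_vec n. mat n n (\<lambda>(k, j). real j ^ k) *\<^sub>v y = x"
proof -
  define V :: "real mat" where "V = mat n n (\<lambda>(k, j). real j ^ k)"
  have V: "V \<in> carrier_mat n n" unfolding V_def by simp
  have "c = 0\<^sub>v n" if c: "c \<in> carrier_vec n" "V\<^sup>T *\<^sub>v c = 0\<^sub>v n" for c
  proof -
    define p where "p = (\<Sum>k<n. monom (c $ k) k)"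
    have coeff: "coeff p k = (if k < n then c $ k else 0)" for k
      unfolding p_def by (simp add: coeff_sum)
    have root: "poly p (real j) = 0" if j: "j < n" for j
    proof -
      have "(V\<^sup>T *\<^sub>v c) $ j = 0" using c(2) j by simp
      then show ?thesis
        using j c(1) unfolding p_def V_def
        by (simp add: poly_sum poly_monom scalar_prod_def mult.commute lessThan_atLeast0)
    qed
    have "p = 0"
    proof (rule ccontr)
      assume "p \<noteq> 0"
      then have "coeff p (degree p) \<noteq> 0" by simp
      then have "degree p < n"
        unfolding coeff by (simp split: if_splits)
      moreover have "card (real ` {..<n}) \<le> card {x. poly p x = 0}"
        using root poly_roots_finite[OF \<open>p \<noteq> 0\<close>] by (intro card_mono) auto
      moreover have "card (real ` {..<n}) = n" by (simp add: card_image)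
      ultimately show False using card_poly_roots_bound[OF \<open>p \<noteq> 0\<close>] by simp
    qed
    then have "c $ k = 0" if "k < n" for k using coeff[of k] that by simp
    then show ?thesis using c(1) by (intro eq_vecI) auto
  qed
  then have "det V\<^sup>T \<noteq> 0"
    using det_0_iff_vec_prod_zero_field[of "V\<^sup>T" n] V by auto
  then have "det V \<noteq> 0" using det_transpose[OF V] by simp
  then have "V \<in> Units (ring_mat TYPE(real) n ())" by (rule det_non_zero_imp_unit[OF V])
  then obtain B where B: "B \<in> carrier_mat n n" "V * B = 1\<^sub>m n"
    unfolding Units_def by (auto simp: ring_mat_simps)
  have "V *\<^sub>v (B *\<^sub>v x) = x"
    using assoc_mult_mat_vec[OF V B(1) x] B(2) x by simp
  then show ?thesis using B(1) x unfolding V_def[symmetric] by (intro bexI[of _ "B *\<^sub>v x"]) auto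
qed

text \<open>Rows of \<open>A\<close> and their differences lie in the column space of the transpose.
  They supply all unit vectors, so the transpose has rank \<open>nc\<close>, and rank-nullity gives
  its kernel. The additive form avoids truncated subtraction.\<close>

lemma kernel_dim_transpose_eq:
  fixes A :: "'a :: field mat"
  assumes A: "A \<in> carrier_mat nr nc"
    and unit: "\<And>k. k < nc \<Longrightarrow> (\<exists>i < nr. row A i = unit_vec nc k) \<or>
      (\<exists>i < nr. \<exists>j < nr. row A i - row A j = unit_vec nc k)"
  shows "kernel_dim A\<^sup>T + nc = nr"
proof -
  have At: "A\<^sup>T \<in> carrier_mat nc nr" using A by simp
  interpret R: vec_space "TYPE('a)" nc .
  have row: "A\<^sup>T *\<^sub>v unit_vec nr i = row A i" if "i < nr" for i
    using that A by (intro eq_vecI) auto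
  have "\<exists>x \<in> carrier_vec nr. A\<^sup>T *\<^sub>v x = unit_vec nc k" if k: "k < nc" for k
    using unit[OF k]
  proof (elim disjE exE conjE)
    fix i assume "i < nr" "row A i = unit_vec nc k"
    then show ?thesis using row by (intro bexI[of _ "unit_vec nr i"]) auto
  next
    fix i j assume "i < nr" "j < nr" "row A i - row A j = unit_vec nc k"
    then show ?thesis using row mult_minus_distrib_mat_vec[OF At]
      by (intro bexI[of _ "unit_vec nr i - unit_vec nr j"]) auto
  qed
  then have "R.rank A\<^sup>T = nc"
    using A by (intro rank_eq_if_unit_vecs_in_span[OF At]) (auto simp: R.col_space_eq[OF At])
  then show ?thesis using rank_plus_kernel_dim[OF At] by simp
qed

section \<open>Modular functions on families of finite sets\<close>

text \<open>The combinatorial core: \<open>f\<close> stands for a point of the relation locus, read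
  as a function on the poset, and \<open>x\<close> for its preimage under the matrix. In the
  induction on the size of \<open>s\<close>, either \<open>s\<close> is the least member with its
  maximum \<open>k\<close>, and then \<open>x k\<close> is chosen to fit, or the lower cover of
  \<open>s\<close> has two elements and inclusion-exclusion applies.\<close>

lemma modular_imp_sum:
  fixes P :: "nat set set" and f :: "nat set \<Rightarrow> 'a :: ab_group_add"
  assumes fin: "finite P" "\<And>s. s \<in> P \<Longrightarrow> finite s"
    and inter: "\<And>s t. s \<in> P \<Longrightarrow> t \<in> P \<Longrightarrow> s \<inter> t \<in> P"
    and remove_Max: "\<And>s. s \<in> P \<Longrightarrow> 2 \<le> card s \<Longrightarrow> s - {Max s} \<in> P"
    and chain: "\<And>s t. s \<in> P \<Longrightarrow> t \<in> P \<Longrightarrow> s \<noteq> {} \<Longrightarrow> t \<noteq> {} \<Longrightarrow> Max s = Max t \<Longrightarrow>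
      s \<subseteq> t \<or> t \<subseteq> s"
    and f_empty: "{} \<in> P \<Longrightarrow> f {} = 0"
    and f_cover: "\<And>s t u. s \<in> P \<Longrightarrow> t \<in> P \<Longrightarrow> u \<in> P \<Longrightarrow> \<Union> {v \<in> P. v \<subset> s} = s \<Longrightarrow>
      {v \<in> P. v \<subset> s \<and> \<not> (\<exists>w \<in> P. v \<subset> w \<and> w \<subset> s)} = {t, u} \<Longrightarrow> f s = f t + f u - f (t \<inter> u)"
  shows "\<exists>x. \<forall>s \<in> P. f s = sum x s"
proof -
  \<comment> \<open>Members with the same maximum form a chain in a finite family, so if there are
    any with maximum \<open>k\<close>, this intersection is the smallest of them.\<close>
  define least where "least k = \<Inter> {s \<in> P. s \<noteq> {} \<and> Max s = k}" for k
  \<comment> \<open>The increment of \<open>f\<close> caused by adding \<open>k\<close>. If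
    \<open>least k\<close> is a singleton, the empty set need not belong to \<open>P\<close>, so
    \<open>f {}\<close> is replaced by the value 0 that the empty sum requires.\<close>
  define x where
    "x k = f (least k) - (if 2 \<le> card (least k) then f (least k - {k}) else 0)" for k
  have "f s = sum x s" if "s \<in> P" for s
    using that
  proof (induction "card s" arbitrary: s rule: less_induct)
    case less
    note s = \<open>s \<in> P\<close>
    have fs: "finite s" using fin(2) s .
    show ?case
    proof (cases "s = {}")
      case True
      then show ?thesis using f_empty s by simp
    next
      case False
      define k where "k = Max s"
      have k: "k \<in> s" using fs False k_def Max_in by auto
      have Max_eq: "Max v = k" if "v \<subseteq> s" "k \<in> v" for v
        using that fs finite_subset[OF that(1)] by (intro Max_eqI) (auto simp: k_def)
      show ?thesis
      proof (cases "\<exists>v \<in> P. v \<subset> s \<and> k \<in> v")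
        case False
        \<comment> \<open>By \<open>chain\<close>, \<open>s\<close> is comparable with
          \<open>t\<close>; no proper subset of \<open>s\<close> in \<open>P\<close> contains
          \<open>k\<close>, so \<open>t\<close> cannot lie strictly below \<open>s\<close>.\<close>
        have "s \<subseteq> t" if t: "t \<in> P" "t \<noteq> {}" "Max t = k" for t
        proof -
          have "k \<in> t" using t fin(2) Max_in by blast
          then have "\<not> t \<subset> s" using False t(1) by blast
          then show ?thesis using chain[OF s t(1) \<open>s \<noteq> {}\<close> t(2)] t(3) k_def by auto
        qed
        then have "least k = s"
          unfolding least_def using s k k_def by blast
        then have x: "x k = f s - (if 2 \<le> card s then f (s - {k}) else 0)"
          unfolding x_def by simp
        have sum_s: "sum x s = x k + sum x (s - {k})"
          using fs k by (rule sum.remove)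
        show ?thesis
        proof (cases "2 \<le> card s")
          case True
          have "f (s - {k}) = sum x (s - {k})"
            using remove_Max[OF s True] card_Diff1_less[OF fs k] unfolding k_def
            by (intro less.hyps)
          then show ?thesis using True x sum_s by simp
        next
          case False
          then have "card (s - {k}) = 0" using k fs by simp
          then have "s - {k} = {}" using fs by (meson card_0_eq finite_Diff)
          then have "sum x (s - {k}) = sum x {}" by (rule arg_cong)
          then show ?thesis using False x sum_s by simp
        qed
      next
        case True
        \<comment> \<open>A maximal element \<open>u\<close> of \<open>U\<close> will form the lower
          cover of \<open>s\<close> together with \<open>t = s - {k}\<close>: a member properly
          inside \<open>s\<close> either avoids \<open>k\<close>, or contains \<open>k\<close> and
          is comparable with \<open>u\<close>.\<close>
        define U where "U = {v \<in> P. v \<subset> s \<and> k \<in> v}"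
        have "finite U" "U \<noteq> {}" using fin(1) True unfolding U_def by auto
        then obtain u where u: "u \<in> U" and u_max: "\<And>v. v \<in> U \<Longrightarrow> u \<subseteq> v \<Longrightarrow> u = v"
          using finite_has_maximal[of U] by blast
        then have uP: "u \<in> P" "u \<subset> s" "k \<in> u" unfolding U_def by auto
        define t where "t = s - {k}"
        have "card u < card s" using uP(2) fs psubset_card_mono by blast
        moreover have "0 < card u" using uP fin(2) card_gt_0_iff by blast
        \<comment> \<open>The nonempty proper subset \<open>u\<close> forces a second element into
          \<open>s\<close>, as \<open>remove_Max\<close> demands.\<close>
        ultimately have "2 \<le> card s" by simp
        then have t: "t \<in> P" using remove_Max[OF s] unfolding t_def k_def by simp
        have ts: "t \<subset> s" unfolding t_def using k by auto
        have v_le: "v \<subseteq> t \<or> v \<subseteq> u" if v: "v \<in> P" "v \<subset> s" for v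
        proof (cases "k \<in> v")
          case True
          have "v \<subseteq> u \<or> u \<subseteq> v"
            using Max_eq[of v] Max_eq[of u] v uP True by (intro chain) auto
          then show ?thesis using u_max[of v] v True unfolding U_def by auto
        next
          case False
          then show ?thesis using v unfolding t_def by auto
        qed
        have cover: "{v \<in> P. v \<subset> s \<and> \<not> (\<exists>w \<in> P. v \<subset> w \<and> w \<subset> s)} = {t, u}" (is "?L = _")
        proof
          show "?L \<subseteq> {t, u}"
          proof
            fix v assume v: "v \<in> ?L"
            then have "\<not> v \<subset> t" "\<not> v \<subset> u" using t ts uP by auto
            then show "v \<in> {t, u}" using v_le[of v] v by auto
          qed
          have "\<not> (\<exists>w \<in> P. t \<subset> w \<and> w \<subset> s)" unfolding t_def using k by blast
          moreover have "\<not> (\<exists>w \<in> P. u \<subset> w \<and> w \<subset> s)"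
            using u_max uP(3) unfolding U_def by blast
          ultimately show "{t, u} \<subseteq> ?L" using t ts uP by blast
        qed
        have tu: "t \<union> u = s" using uP k unfolding t_def by auto
        \<comment> \<open>This is the residue condition: the two members \<open>t\<close> and
          \<open>u\<close> below \<open>s\<close> already cover it.\<close>
        have "\<Union> {v \<in> P. v \<subset> s} = s" using tu t ts uP(1,2) by auto
        then have "f s = f t + f u - f (t \<inter> u)" using f_cover s t uP(1) cover by blast
        also have "\<dots> = sum x t + sum x u - sum x (t \<inter> u)"
        proof -
          have "t \<inter> u \<subset> s" using ts by auto
          then show ?thesis
            using less.hyps[OF psubset_card_mono[OF fs ts] t]
              less.hyps[OF psubset_card_mono[OF fs uP(2)] uP(1)]
              less.hyps[OF psubset_card_mono[OF fs \<open>t \<inter> u \<subset> s\<close>] inter[OF t uP(1)]] by simp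
        qed
        also have "\<dots> = sum x (t \<union> u)"
          using sum_Un[of t u x] fin(2) t uP(1) by simp
        finally show ?thesis unfolding tu .
      qed
    qed
  qed
  then show ?thesis by blast
qed

section \<open>Directed trees and their treks\<close>

text \<open>Let \<open>z\<close> be the last vertex of \<open>p\<close> that also lies on
  \<open>q\<close>. The two stretches from \<open>z\<close> to \<open>v\<close> share only their
  ends, so running along one and back along the other is a cycle.\<close>

lemma undirected_cycle_of_two_paths:
  assumes "successively (\<lambda>u v. (u, v) \<in> E) (p @ [v])" "successively (\<lambda>u v. (u, v) \<in> E) (q @ [v])"
    and ne: "p \<noteq> []" "q \<noteq> []" and hd: "hd p = hd q" and last: "last p \<noteq> last q"
    and dist: "distinct (p @ [v])" "distinct (q @ [v])"
  shows "\<exists>c. undirected_cycle E c"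
proof -
  have "\<exists>z \<in> set p. z \<in> set q" using ne hd by (metis hd_in_set)
  then obtain a z b where p: "p = a @ z # b" and z: "z \<in> set q" and b: "\<forall>y \<in> set b. y \<notin> set q"
    using split_list_last_prop[of p "\<lambda>z. z \<in> set q"] by blast
  obtain c d where q: "q = c @ z # d" using z split_list by metis
  have "successively (\<lambda>u v. (u, v) \<in> E) (z # b @ [v])"
    using assms(1) unfolding p by (auto simp: successively_append_iff)
  then have 1: "successively (\<lambda>u v. (u, v) \<in> E \<union> E\<inverse>) (z # b @ [v])"
    by (rule successively_mono) auto
  have "successively (\<lambda>u v. (u, v) \<in> E) (z # d @ [v])"
    using assms(2) unfolding q by (auto simp: successively_append_iff)
  then have "successively (\<lambda>u v. (u, v) \<in> E \<union> E\<inverse>) (z # d @ [v])"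
    by (rule successively_mono) auto
  then have "successively (\<lambda>u v. (u, v) \<in> E \<union> E\<inverse>) (rev (z # d @ [v]))"
    unfolding successively_rev by (rule successively_mono) auto
  then have 2: "successively (\<lambda>u v. (u, v) \<in> E \<union> E\<inverse>) ((v # rev d) @ [z])" by simp
  have 3: "successively (\<lambda>u v. (u, v) \<in> E \<union> E\<inverse>) (z # b @ v # rev d)"
    using 1 2 successively_append_iff[of "\<lambda>u v. (u, v) \<in> E \<union> E\<inverse>" "z # b" "[v]"]
      successively_append_iff[of "\<lambda>u v. (u, v) \<in> E \<union> E\<inverse>" "z # b" "v # rev d"]
      successively_append_iff[of "\<lambda>u v. (u, v) \<in> E \<union> E\<inverse>" "v # rev d" "[z]"]
    by simp
  have 4: "(last (v # rev d), z) \<in> E \<union> E\<inverse>"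
    using 2 by (auto simp: successively_append_iff simp del: append_Cons)
  \<comment> \<open>If both stretches were single edges, \<open>p\<close> and \<open>q\<close> would
    both end in \<open>z\<close>. Hence the cycle has a third vertex.\<close>
  have "b \<noteq> [] \<or> d \<noteq> []" using last unfolding p q by auto
  then have "3 \<le> length (z # b @ v # rev d)"
    by (cases b; cases d) auto
  moreover have "distinct (z # b @ v # rev d)"
    using dist b unfolding p q by auto
  moreover have "(last (z # b @ v # rev d), hd (z # b @ v # rev d)) \<in> E \<union> E\<inverse>"
    using 4 by simp
  ultimately show ?thesis using 3 unfolding undirected_cycle_def by blast
qed

section \<open>Uniqueness of paths from the root\<close>

locale dtree =
  fixes m :: nat and E :: "(nat \<times> nat) set"
  assumes tree: "directed_tree m E"
begin

abbreviation path :: "nat list \<Rightarrow> bool" where "path \<equiv> directed_path m E"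

lemma edgeD: "(u, v) \<in> E \<Longrightarrow> u \<in> {1..m} \<and> v \<in> {1..m}"
  using tree unfolding directed_tree_def by auto

lemma wf_edges: "wf E"
proof -
  have "finite E" using tree finite_subset unfolding directed_tree_def by blast
  then show ?thesis using tree finite_acyclic_wf unfolding directed_tree_def by blast
qed

definition root :: nat where "root = (THE r. r \<in> {1..m} \<and> (\<forall>u. (u, r) \<notin> E))"

lemma root_in: "root \<in> {1..m}" and no_edge_to_root: "(u, root) \<notin> E"
  using theI'[of "\<lambda>r. r \<in> {1..m} \<and> (\<forall>u. (u, r) \<notin> E)"] tree
  unfolding directed_tree_def root_def by blast+

lemma parent_exists: "v \<in> {1..m} \<Longrightarrow> v \<noteq> root \<Longrightarrow> \<exists>u. (u, v) \<in> E"
  using root_in no_edge_to_root tree unfolding directed_tree_def by blast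

lemma path_in: "path p \<Longrightarrow> v \<in> set p \<Longrightarrow> v \<in> {1..m}"
  unfolding directed_path_def by blast

lemma last_path_in: "path p \<Longrightarrow> last p \<in> {1..m}"
  using path_in last_in_set unfolding directed_path_def by blast

lemma path_singleton: "path [v] \<longleftrightarrow> v \<in> {1..m}"
  unfolding directed_path_def by simp

lemma path_snoc: "p \<noteq> [] \<Longrightarrow> path (p @ [v]) \<longleftrightarrow> path p \<and> (last p, v) \<in> E"
  unfolding directed_path_def by (auto simp: successively_append_iff dest: edgeD)

lemma path_append:
  "p \<noteq> [] \<Longrightarrow> q \<noteq> [] \<Longrightarrow> path (p @ q) \<longleftrightarrow> path p \<and> path q \<and> (last p, hd q) \<in> E"
  unfolding directed_path_def by (auto simp: successively_append_iff)

text \<open>Any two vertices of a path, in order, are related by the transitive closure of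
  \<open>E\<close>, which is irreflexive by acyclicity.\<close>

lemma path_distinct:
  assumes "path p"
  shows "distinct p"
proof -
  have "successively (\<lambda>u v. (u, v) \<in> E\<^sup>+) p"
    using assms unfolding directed_path_def by (auto elim: successively_mono)
  then have "sorted_wrt (\<lambda>u v. (u, v) \<in> E\<^sup>+) p"
    by (subst (asm) successively_conv_sorted_wrt) (auto intro: transpI)
  then show ?thesis
    using tree unfolding directed_tree_def acyclic_def
    by (auto simp: distinct_conv_nth sorted_wrt_iff_nth_less) (metis linorder_neqE_nat)
qed

text \<open>Well-founded induction along the edges: every vertex other than the root has a parent,
  whose root path is extended by one edge.\<close>

lemma ex_root_path: "v \<in> {1..m} \<Longrightarrow> \<exists>p. path p \<and> hd p = root \<and> last p = v"
proof (induction v rule: wf_induct_rule[OF wf_edges])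
  case (1 v)
  show ?case
  proof (cases "v = root")
    case True
    then show ?thesis using path_singleton[of v] 1(2) by (intro exI[of _ "[v]"]) auto
  next
    case False
    then obtain u where u: "(u, v) \<in> E" using parent_exists 1(2) by blast
    then obtain p where p: "path p" "hd p = root" "last p = u" using 1(1) edgeD by blast
    have "p \<noteq> []" using p(1) unfolding directed_path_def by simp
    then show ?thesis using p u path_snoc[of p v] by (intro exI[of _ "p @ [v]"]) auto
  qed
qed

text \<open>Two different parents of \<open>v\<close> would give two root paths entering
  \<open>v\<close> through different vertices, hence an undirected cycle.\<close>

lemma unique_parent:
  assumes "(u, v) \<in> E" "(u', v) \<in> E"
  shows "u = u'"
proof (rule ccontr)
  assume ne: "u \<noteq> u'"
  obtain p where p: "path p" "hd p = root" "last p = u" using ex_root_path edgeD assms(1) by blast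
  obtain q where q: "path q" "hd q = root" "last q = u'" using ex_root_path edgeD assms(2) by blast
  have "p \<noteq> []" "q \<noteq> []" using p(1) q(1) unfolding directed_path_def by auto
  moreover from this have pv: "path (p @ [v])" "path (q @ [v])"
    using p q assms path_snoc by auto
  ultimately have "\<exists>c. undirected_cycle E c"
    using ne p q path_distinct[OF pv(1)] path_distinct[OF pv(2)]
    by (intro undirected_cycle_of_two_paths[of E p v q]) (auto simp: directed_path_def)
  then show False using tree unfolding directed_tree_def underlying_tree_def by blast
qed

text \<open>Read backwards from the common end, both paths are forced by uniqueness of parents. The
  path \<open>q\<close> cannot run out first, because it starts at the root, which has no
  parent.\<close>

lemma suffix_of_root_path:
  assumes "path p" "path q" "hd q = root" "last p = last q"
  shows "suffix p q"
  using assms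
proof (induction p arbitrary: q rule: rev_induct)
  case Nil
  then show ?case by simp
next
  case (snoc v p)
  have "q \<noteq> []" using snoc.prems(2) unfolding directed_path_def by auto
  then obtain q' where q: "q = q' @ [v]"
    using snoc.prems(4) by (metis append_butlast_last_id last_snoc)
  show ?case
  proof (cases "p = []")
    case True
    then show ?thesis unfolding q by (simp add: suffix_def)
  next
    case False
    then have p: "path p" "(last p, v) \<in> E" using snoc.prems(1) path_snoc by auto
    have "q' \<noteq> []" using p(2) no_edge_to_root snoc.prems(3) q by auto
    then have "path q'" "(last q', v) \<in> E" "hd q' = root"
      using snoc.prems(2,3) path_snoc q by auto
    then have "suffix p q'" using snoc.IH p unique_parent by blast
    then show ?thesis unfolding q by (auto simp: suffix_def)
  qed
qed

text \<open>The choice is unique by \<open>root_path_eqI\<close>. The entry at position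
  \<open>x\<close> is the ancestor of \<open>v\<close> at depth \<open>x\<close>.\<close>

definition root_path :: "nat \<Rightarrow> nat list" where
  "root_path v = (SOME p. path p \<and> hd p = root \<and> last p = v)"

lemma root_path:
  assumes "v \<in> {1..m}"
  shows "path (root_path v)" "hd (root_path v) = root" "last (root_path v) = v"
  using someI_ex[OF ex_root_path[OF assms]] unfolding root_path_def by auto

lemma path_imp_suffix: "path p \<Longrightarrow> suffix p (root_path (last p))"
proof -
  assume p: "path p"
  then have "last p \<in> {1..m}" by (rule last_path_in)
  then show ?thesis using p root_path suffix_of_root_path by metis
qed

lemma root_path_eqI: "path p \<Longrightarrow> hd p = root \<Longrightarrow> last p = v \<Longrightarrow> root_path v = p"
proof -
  assume p: "path p" "hd p = root" "last p = v"
  then have "v \<in> {1..m}" using last_path_in by blast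
  then show ?thesis
    using p root_path suffix_of_root_path suffix_order.antisym by metis
qed

section \<open>Treks as common ancestors\<close>

definition depth :: "nat \<Rightarrow> nat" where "depth v = path_length (root_path v)"

lemma length_root_path: "v \<in> {1..m} \<Longrightarrow> length (root_path v) = Suc (depth v)"
  using root_path(1)[of v] unfolding depth_def path_length_def directed_path_def
  by (cases "root_path v") auto

text \<open>The depths of the common ancestors of \<open>i\<close> and \<open>j\<close>, recorded as
  agreement of the root paths up to position \<open>x\<close>. The bounds rule out positions past
  the end of a path, where \<open>take\<close> is constant.\<close>

definition common :: "nat \<Rightarrow> nat \<Rightarrow> nat set" where
  "common i j = {x. x \<le> depth i \<and> x \<le> depth j \<and>
     take (Suc x) (root_path i) = take (Suc x) (root_path j)}"

lemma root_path_ancestor: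
  assumes v: "v \<in> {1..m}" and x: "x \<le> depth v"
  shows "root_path (root_path v ! x) = take (Suc x) (root_path v)"
    and "root_path v ! x \<in> {1..m}" and "depth (root_path v ! x) = x"
proof -
  let ?A = "root_path v"
  have len: "x < length ?A" using length_root_path[OF v] x by simp
  have "?A = take (Suc x) ?A @ drop (Suc x) ?A" by simp
  have "path (take (Suc x) ?A)"
  proof (cases "drop (Suc x) ?A = []")
    case True
    then show ?thesis using root_path(1)[OF v] by simp
  next
    case False
    moreover have "take (Suc x) ?A \<noteq> []" using len by auto
    ultimately show ?thesis
      using path_append[of "take (Suc x) ?A" "drop (Suc x) ?A"] root_path(1)[OF v] by simp
  qed
  moreover have "hd (take (Suc x) ?A) = root"
    using len root_path(2)[OF v] by simp
  moreover have "last (take (Suc x) ?A) = ?A ! x"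
    using len by (simp add: take_Suc_conv_app_nth)
  ultimately show eq: "root_path (?A ! x) = take (Suc x) ?A" by (rule root_path_eqI)
  show "?A ! x \<in> {1..m}" using root_path(1)[OF v] len by (intro path_in) auto
  show "depth (?A ! x) = x" unfolding depth_def eq path_length_def using len by simp
qed

text \<open>Each half of a trek is a suffix of a root path, so a trek is determined by its top, and
  the top by its depth \<open>x\<close>. Cutting both root paths at a common ancestor conversely
  yields a trek.\<close>

lemma treks_eq:
  assumes i: "i \<in> {1..m}" and j: "j \<in> {1..m}"
  shows "treks m E i j = (\<lambda>x. (drop x (root_path i), drop x (root_path j))) ` common i j"
    (is "_ = ?f ` _")
proof
  have drop_path: "path (drop x (root_path v))" "last (drop x (root_path v)) = v"
    if "v \<in> {1..m}" "x \<le> depth v" for v x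
  proof -
    have l: "x < length (root_path v)" using length_root_path that by simp
    show "path (drop x (root_path v))"
    proof (cases "x = 0")
      case True
      then show ?thesis using root_path(1)[OF that(1)] by simp
    next
      case False
      then have "take x (root_path v) \<noteq> []" "drop x (root_path v) \<noteq> []" using l by auto
      then show ?thesis
        using path_append[of "take x (root_path v)" "drop x (root_path v)"] root_path(1)[OF that(1)]
        by simp
    qed
    show "last (drop x (root_path v)) = v" using l root_path(3)[OF that(1)] by simp
  qed
  show "?f ` common i j \<subseteq> treks m E i j"
  proof
    fix T assume "T \<in> ?f ` common i j"
    then obtain x where T: "T = ?f x" and x: "x \<le> depth i" "x \<le> depth j"
      and eq: "take (Suc x) (root_path i) = take (Suc x) (root_path j)"
      unfolding common_def by auto
    have l: "x < length (root_path i)" "x < length (root_path j)"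
      using length_root_path i j x by auto
    have "root_path i ! x = root_path j ! x" using eq by (metis lessI nth_take)
    then have "hd (drop x (root_path i)) = hd (drop x (root_path j))"
      using l by (simp add: hd_drop_conv_nth)
    then show "T \<in> treks m E i j"
      using drop_path i j x unfolding T treks_def by simp
  qed
  show "treks m E i j \<subseteq> ?f ` common i j"
  proof
    fix T assume "T \<in> treks m E i j"
    then obtain P Q where T: "T = (P, Q)" and P: "path P" "last P = i" and Q: "path Q" "last Q = j"
      and hd: "hd P = hd Q" unfolding treks_def by auto
    have ne: "P \<noteq> []" "Q \<noteq> []" using P Q unfolding directed_path_def by auto
    obtain p where p: "root_path i = p @ P"
      using path_imp_suffix[OF P(1)] P(2) unfolding suffix_def by auto
    obtain q where q: "root_path j = q @ Q"
      using path_imp_suffix[OF Q(1)] Q(2) unfolding suffix_def by auto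
    have lp: "length p \<le> depth i" and lq: "length q \<le> depth j"
      using length_root_path[OF i] length_root_path[OF j] ne unfolding p q
      by (cases P; cases Q; simp)+
    have "root_path i ! length p = root_path j ! length q"
      using hd ne unfolding p q by (simp add: nth_append hd_conv_nth)
    \<comment> \<open>Both halves start at the same top vertex. Its root path is an initial segment
      of both root paths, and its depth is the length of the part cut off from either.\<close>
    then have eq: "take (Suc (length p)) (root_path i) = take (Suc (length q)) (root_path j)"
      and len: "length p = length q"
      using root_path_ancestor[OF i lp] root_path_ancestor[OF j lq] by auto
    then have "length p \<in> common i j" using lp lq unfolding common_def by auto
    moreover have "T = ?f (length p)" using len by (simp add: T p q)
    ultimately show "T \<in> ?f ` common i j" by blast
  qed
qed

definition meet_depth :: "nat \<Rightarrow> nat \<Rightarrow> nat" where "meet_depth i j = Max (common i j)"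

text \<open>The root is a common ancestor, so the set is nonempty, and ancestors of common ancestors
  are common. \<open>meet_depth\<close> is thus the depth of the lowest common ancestor.\<close>

lemma common_eq:
  assumes "i \<in> {1..m}" "j \<in> {1..m}"
  shows "common i j = {..meet_depth i j}"
proof -
  have fin: "finite (common i j)" unfolding common_def by simp
  have "root_path i \<noteq> []" "root_path j \<noteq> []"
    using length_root_path assms by force+
  then have "0 \<in> common i j"
    using root_path(2)[of i] root_path(2)[of j] assms
    unfolding common_def by (simp add: take_Suc)
  then have "meet_depth i j \<in> common i j" using fin Max_in unfolding meet_depth_def by blast
  moreover have "y \<in> common i j" if "x \<in> common i j" "y \<le> x" for x y
  proof -
    have "take (Suc y) (take (Suc x) (root_path i)) = take (Suc y) (take (Suc x) (root_path j))"
      using that unfolding common_def by simp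
    then show ?thesis using that unfolding common_def by simp
  qed
  ultimately show ?thesis
    using fin Max_ge unfolding meet_depth_def by blast
qed

lemma meet_depth_le:
  assumes "i \<in> {1..m}" "j \<in> {1..m}"
  shows "meet_depth i j \<le> depth i" "meet_depth i j \<le> depth j"
  using common_eq[OF assms] unfolding common_def by auto

end

section \<open>Sets of trek lengths\<close>

text \<open>The progression \<open>e - 2 * c, ..., e - 2, e\<close>. Subtraction truncates at 0, so
  this reading requires \<open>2 * c \<le> e\<close>.\<close>

definition parity_interval :: "nat \<Rightarrow> nat \<Rightarrow> nat set" where
  "parity_interval e c = (\<lambda>x. e - 2 * x) ` {..c}"

lemma finite_parity_interval [simp]: "finite (parity_interval e c)"
  unfolding parity_interval_def by simp

lemma parity_interval_subset: "parity_interval e c \<subseteq> {..e}"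
  unfolding parity_interval_def by auto

lemma top_in_parity_interval: "e \<in> parity_interval e c"
  unfolding parity_interval_def by (auto intro: image_eqI[of _ _ 0])

lemma Max_parity_interval: "Max (parity_interval e c) = e"
  using top_in_parity_interval parity_interval_subset[of e c] by (intro Max_eqI) auto

lemma parity_interval_mono: "c \<le> c' \<Longrightarrow> parity_interval e c \<subseteq> parity_interval e c'"
  unfolding parity_interval_def by auto

lemma mem_parity_interval:
  assumes "2 * c \<le> e"
  shows "k \<in> parity_interval e c \<longleftrightarrow> k \<le> e \<and> e \<le> k + 2 * c \<and> even (e - k)"
proof
  assume "k \<in> parity_interval e c"
  then obtain x where "x \<le> c" "k = e - 2 * x" unfolding parity_interval_def by auto
  then show "k \<le> e \<and> e \<le> k + 2 * c \<and> even (e - k)" using assms by auto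
next
  assume k: "k \<le> e \<and> e \<le> k + 2 * c \<and> even (e - k)"
  then obtain x where "e - k = 2 * x" by blast
  then have "k = e - 2 * x" "x \<le> c" using k assms by auto
  then show "k \<in> parity_interval e c" unfolding parity_interval_def by blast
qed

text \<open>If the lower top \<open>e\<close> belongs to the other progression, it is also the top
  of the intersection. Otherwise the parities differ or the other progression starts above
  \<open>e\<close>, and the intersection is empty.\<close>

lemma parity_interval_inter_le:
  assumes "2 * c \<le> e" "2 * c' \<le> e'" "e \<le> e'"
  shows "parity_interval e c \<inter> parity_interval e' c' = {} \<or>
    (\<exists>d \<le> c. parity_interval e c \<inter> parity_interval e' c' = parity_interval e d)"
proof (cases "even (e' - e) \<and> (e' - e) div 2 \<le> c'")
  case True
  then obtain y where y: "e' = e + 2 * y" "y \<le> c'"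
    using assms(3) by (metis dvd_div_eq_mult evenE le_add_diff_inverse nonzero_mult_div_cancel_left zero_neq_numeral)
  \<comment> \<open>With \<open>e' = e + 2 * y\<close>, the larger of the two lower ends
    \<open>e - 2 * c\<close> and \<open>e' - 2 * c'\<close> is \<open>e - 2 * d\<close>.\<close>
  define d where "d = min c (c' - y)"
  have "2 * d \<le> e" "d \<le> c" unfolding d_def using assms by auto
  have "k \<in> parity_interval e c \<inter> parity_interval e' c' \<longleftrightarrow> k \<in> parity_interval e d" for k
    using assms y \<open>2 * d \<le> e\<close> unfolding d_def by (auto simp: mem_parity_interval)
  then show ?thesis using \<open>d \<le> c\<close> by blast
next
  case False
  have "\<not> (k \<in> parity_interval e c \<and> k \<in> parity_interval e' c')" for k
  proof
    assume k: "k \<in> parity_interval e c \<and> k \<in> parity_interval e' c'"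
    then have k': "k \<le> e" "even (e - k)" "e' \<le> k + 2 * c'" "even (e' - k)"
      using assms by (auto simp: mem_parity_interval)
    have "e' - e = (e' - k) - (e - k)" using k' assms by simp
    then have "even (e' - e)" using k'(2,4) dvd_diff_nat by metis
    moreover have "(e' - e) div 2 \<le> c'" using k' by simp
    ultimately show False using False by blast
  qed
  then show ?thesis by blast
qed

lemma parity_interval_inter:
  assumes "2 * c \<le> e" "2 * c' \<le> e'"
  shows "parity_interval e c \<inter> parity_interval e' c' = {} \<or>
    (\<exists>d \<le> c. parity_interval e c \<inter> parity_interval e' c' = parity_interval e d) \<or>
    (\<exists>d \<le> c'. parity_interval e c \<inter> parity_interval e' c' = parity_interval e' d)"
  using parity_interval_inter_le[OF assms] parity_interval_inter_le[OF assms(2,1)]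
  by (cases "e \<le> e'") (auto simp: Int_commute)

lemma parity_interval_remove_top:
  assumes "2 * c \<le> e" "0 < c"
  shows "parity_interval e c - {e} = parity_interval (e - 2) (c - 1)"
proof -
  have "k \<in> parity_interval e c - {e} \<longleftrightarrow> k \<in> parity_interval (e - 2) (c - 1)" for k
  proof -
    have "k \<le> e \<and> e \<le> k + 2 * c \<and> even (e - k) \<and> k \<noteq> e \<longleftrightarrow>
      k \<le> e - 2 \<and> e - 2 \<le> k + 2 * (c - 1) \<and> even (e - 2 - k)"
      using assms by (auto; presburger)
    then show ?thesis using assms by (auto simp: mem_parity_interval)
  qed
  then show ?thesis by blast
qed

section \<open>Trek lengths for a pair of vertices\<close>

context dtree
begin

definition lengths :: "nat \<times> nat \<Rightarrow> nat set" where
  "lengths a = parity_interval (depth (fst a) + depth (snd a)) (meet_depth (fst a) (snd a))"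

lemma meet_depth_double_le:
  "i \<in> {1..m} \<Longrightarrow> j \<in> {1..m} \<Longrightarrow> 2 * meet_depth i j \<le> depth i + depth j"
  using meet_depth_le[of i j] by simp

lemma lengths_sym: "lengths (j, i) = lengths (i, j)"
proof -
  have "common i j = common j i" unfolding common_def by auto
  then show ?thesis unfolding lengths_def meet_depth_def by (simp add: add.commute)
qed

text \<open>Pairs built from ancestors need not be ordered as vertex numbers; symmetry of
  \<open>lengths\<close> allows swapping them.\<close>

lemma ex_index_pair:
  assumes "i \<in> {1..m}" "j \<in> {1..m}"
  shows "\<exists>a \<in> index_pairs m. lengths a = lengths (i, j)"
proof (cases "i \<le> j")
  case True
  then show ?thesis using assms by (intro bexI[of _ "(i, j)"]) (auto simp: index_pairs_def)
next
  case False
  then show ?thesis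
    using assms lengths_sym[of i j] by (intro bexI[of _ "(j, i)"]) (auto simp: index_pairs_def)
qed

lemma index_pairsD: "(i, j) \<in> index_pairs m \<Longrightarrow> i \<in> {1..m} \<and> j \<in> {1..m}"
  unfolding index_pairs_def by auto

lemma trek_length_drop:
  assumes "i \<in> {1..m}" "j \<in> {1..m}" "x \<in> common i j"
  shows "trek_length (drop x (root_path i), drop x (root_path j)) = depth i + depth j - 2 * x"
  using assms length_root_path unfolding common_def trek_length_def path_length_def by simp

lemma trek_lengths:
  assumes "i \<in> {1..m}" "j \<in> {1..m}"
  shows "trek_length ` treks m E i j = lengths (i, j)"
  unfolding treks_eq[OF assms] lengths_def parity_interval_def fst_conv snd_conv
    common_eq[OF assms, symmetric] image_image
  using trek_length_drop[OF assms] by (intro image_cong) auto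

text \<open>The length \<open>depth i + depth j - 2 * x\<close> determines the depth
  \<open>x\<close> of the top, so no two treks between \<open>i\<close> and \<open>j\<close> have
  the same length. This makes the coefficient vectors 0-1 vectors.\<close>

lemma card_treks:
  assumes "i \<in> {1..m}" "j \<in> {1..m}"
  shows "card {T \<in> treks m E i j. trek_length T = k} = (if k \<in> lengths (i, j) then 1 else 0)"
proof (cases "k \<in> lengths (i, j)")
  case False
  then have "{T \<in> treks m E i j. trek_length T = k} = {}" using trek_lengths[OF assms] by auto
  then show ?thesis using False by (simp only: card.empty if_False)
next
  case True
  then obtain x where x: "x \<in> common i j" "k = depth i + depth j - 2 * x"
    unfolding lengths_def parity_interval_def common_eq[OF assms] by auto
  let ?f = "\<lambda>y. (drop y (root_path i), drop y (root_path j))"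
  have "{y \<in> common i j. depth i + depth j - 2 * y = k} = {x}"
  proof -
    have "y = x" if y: "y \<in> common i j" "k = depth i + depth j - 2 * y" for y
      using x y meet_depth_le[OF assms] unfolding common_eq[OF assms] by auto
    then show ?thesis using x by auto
  qed
  moreover have "{T \<in> treks m E i j. trek_length T = k} =
      ?f ` {y \<in> common i j. depth i + depth j - 2 * y = k}"
    unfolding treks_eq[OF assms] using trek_length_drop[OF assms] by auto
  ultimately have "{T \<in> treks m E i j. trek_length T = k} = {?f x}" by simp
  then show ?thesis using True by simp
qed

section \<open>The height and the longest trek\<close>

lemma ex_deepest: "\<exists>v \<in> {1..m}. \<forall>u \<in> {1..m}. depth u \<le> depth v"
proof -
  have "Max (depth ` {1..m}) \<in> depth ` {1..m}" using root_in by (intro Max_in) auto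
  then obtain v where "v \<in> {1..m}" "depth v = Max (depth ` {1..m})" by auto
  then show ?thesis by (intro bexI[of _ v]) auto
qed

definition deepest :: nat where
  "deepest = (SOME v. v \<in> {1..m} \<and> (\<forall>u \<in> {1..m}. depth u \<le> depth v))"

lemma deepest: "deepest \<in> {1..m}" "u \<in> {1..m} \<Longrightarrow> depth u \<le> depth deepest"
  using someI_ex[of "\<lambda>v. v \<in> {1..m} \<and> (\<forall>u \<in> {1..m}. depth u \<le> depth v)"] ex_deepest
  unfolding deepest_def by blast+

text \<open>Every path is a suffix of a root path, so none is longer than the root path to a deepest
  vertex.\<close>

lemma height_eq: "height m E = depth deepest"
  unfolding height_def
proof (rule Max_eqI)
  have le: "path_length p \<le> depth deepest" if p: "path p" for p
  proof -
    have "length p \<le> length (root_path (last p))"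
      using path_imp_suffix[OF p] by (auto simp: suffix_def)
    then have "path_length p \<le> depth (last p)" unfolding path_length_def depth_def by simp
    then show ?thesis using deepest(2)[OF last_path_in[OF p]] by simp
  qed
  then have bound: "{path_length p |p. path p} \<subseteq> {..depth deepest}" by blast
  then show "y \<le> depth deepest" if "y \<in> {path_length p |p. path p}" for y
    using that by blast
  show "finite {path_length p |p. path p}"
    using bound by (rule finite_subset) simp
  show "depth deepest \<in> {path_length p |p. path p}"
    using root_path(1)[OF deepest(1)] unfolding depth_def by auto
qed

lemma treks_ends: "T \<in> treks m E i j \<Longrightarrow> i \<in> {1..m} \<and> j \<in> {1..m}"
  using last_path_in unfolding treks_def by blast

text \<open>A trek is at most as long as the sum of the depths of its ends. The bound is attained by
  descending twice from the root to a deepest vertex.\<close>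

lemma max_trek_length_eq: "max_trek_length m E = 2 * depth deepest"
  unfolding max_trek_length_def
proof (rule Max_eqI)
  have le: "trek_length T \<le> 2 * depth deepest" if T: "T \<in> treks m E i j" for T i j
  proof -
    have ij: "i \<in> {1..m}" "j \<in> {1..m}" using treks_ends[OF T] by auto
    have "trek_length T \<in> lengths (i, j)" using trek_lengths[OF ij] T by blast
    then have "trek_length T \<le> depth i + depth j"
      using parity_interval_subset unfolding lengths_def by fastforce
    then show ?thesis using deepest(2)[OF ij(1)] deepest(2)[OF ij(2)] by simp
  qed
  then have bound: "{trek_length T |T i j. T \<in> treks m E i j} \<subseteq> {..2 * depth deepest}" by blast
  then show "y \<le> 2 * depth deepest" if "y \<in> {trek_length T |T i j. T \<in> treks m E i j}" for y
    using that by blast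
  show "finite {trek_length T |T i j. T \<in> treks m E i j}"
    using bound by (rule finite_subset) simp
  have "2 * depth deepest \<in> lengths (deepest, deepest)"
    using top_in_parity_interval unfolding lengths_def by (simp add: mult_2)
  then obtain T where "T \<in> treks m E deepest deepest" "2 * depth deepest = trek_length T"
    using trek_lengths[OF deepest(1) deepest(1)] by blast
  then show "2 * depth deepest \<in> {trek_length T |T i j. T \<in> treks m E i j}" by blast
qed

lemma lengths_subset: 
  assumes "a \<in> index_pairs m"
  shows "lengths a \<subseteq> {..max_trek_length m E}"
proof -
  have "depth (fst a) + depth (snd a) \<le> 2 * depth deepest"
    using deepest(2)[of "fst a"] deepest(2)[of "snd a"] index_pairsD[of "fst a" "snd a"] assms by simp
  then show ?thesis
    unfolding lengths_def max_trek_length_eq using parity_interval_subset by (meson atMost_subset_iff order_trans)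
qed

text \<open>Take the vertices at depths \<open>x\<close> and \<open>y\<close> of one root path: the
  first is an ancestor of the second, so they meet at depth \<open>x\<close>.\<close>

lemma lengths_on_root_path:
  assumes v: "v \<in> {1..m}" and "x \<le> y" "y \<le> depth v"
  shows "\<exists>a \<in> index_pairs m. lengths a = parity_interval (x + y) x"
proof -
  let ?i = "root_path v ! x" and ?j = "root_path v ! y"
  have x: "x \<le> depth v" using assms by simp
  note i = root_path_ancestor[OF v x] and j = root_path_ancestor[OF v assms(3)]
  have "common ?i ?j = {..x}"
    unfolding common_def i(1,3) j(1,3) using assms by (auto simp: min_def)
  then have "meet_depth ?i ?j = x" using common_eq[OF i(2) j(2)] by (metis atMost_eq_iff)
  then have "lengths (?i, ?j) = parity_interval (x + y) x"
    unfolding lengths_def using i(3) j(3) by simp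
  then show ?thesis using ex_index_pair[OF i(2) j(2)] by simp
qed

text \<open>On the root path to a deepest vertex, of depth \<open>h\<close>, the depths 0 and
  \<open>k\<close> give \<open>{k}\<close> if \<open>k \<le> h\<close>. If \<open>k > h\<close>, the
  depths \<open>k - h\<close> and \<open>h\<close> give a progression with top \<open>k\<close>, and
  the two parents give the same progression without \<open>k\<close>. This is the source of full
  rank.\<close>

lemma singleton_lengths_diff:
  assumes "k \<le> max_trek_length m E"
  shows "(\<exists>a \<in> index_pairs m. lengths a = {k}) \<or>
    (\<exists>a \<in> index_pairs m. \<exists>b \<in> index_pairs m. lengths b \<subseteq> lengths a \<and> lengths a - lengths b = {k})"
proof (cases "k \<le> depth deepest")
  case True
  have "parity_interval k 0 = {k}" unfolding parity_interval_def by simp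
  then show ?thesis using lengths_on_root_path[OF deepest(1), of 0 k] True by simp
next
  case False
  let ?h = "depth deepest"
  define x where "x = k - ?h"
  have x: "0 < x" "x \<le> ?h" "k = x + ?h"
    using False assms unfolding x_def max_trek_length_eq by auto
  obtain a where a: "a \<in> index_pairs m" "lengths a = parity_interval k x"
    using lengths_on_root_path[OF deepest(1), of x ?h] x by auto
  have "k - 2 = (x - 1) + (?h - 1)" using x by simp
  then obtain b where b: "b \<in> index_pairs m" "lengths b = parity_interval (k - 2) (x - 1)"
    using lengths_on_root_path[OF deepest(1), of "x - 1" "?h - 1"] diff_le_mono[OF x(2), of 1] by auto
  have "lengths b = lengths a - {k}"
    using parity_interval_remove_top[of x k] x a b by simp
  moreover have "k \<in> lengths a" using a top_in_parity_interval by simp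
  ultimately have "lengths b \<subseteq> lengths a \<and> lengths a - lengths b = {k}" by auto
  then show ?thesis using a(1) b(1) by blast
qed

text \<open>Passing to the parents of both vertices lowers the top by 2, while \<open>c - 1\<close>
  remains the depth of a common ancestor. So everything below \<open>e\<close> survives and
  \<open>e\<close> is lost. The parameter \<open>c\<close> may be smaller than the meet depth, since
  intersections cut progressions off from below.\<close>

lemma lengths_of_parents:
  assumes a: "a \<in> index_pairs m" and c: "0 < c" "c \<le> meet_depth (fst a) (snd a)"
    and e: "e = depth (fst a) + depth (snd a)"
  shows "\<exists>b \<in> index_pairs m. lengths b \<inter> parity_interval e c = parity_interval e c - {e}"
proof -
  define i j where "i = fst a" and "j = snd a"
  have ij: "i \<in> {1..m}" "j \<in> {1..m}"
    using index_pairsD[of i j] a unfolding i_def j_def by auto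
  have le: "c \<le> depth i" "c \<le> depth j"
    using meet_depth_le[OF ij] c unfolding i_def j_def by auto
  define i' j' where "i' = root_path i ! (depth i - 1)" and "j' = root_path j ! (depth j - 1)"
  have i': "root_path i' = take (depth i) (root_path i)" "i' \<in> {1..m}" "depth i' = depth i - 1"
    using root_path_ancestor[OF ij(1), of "depth i - 1"] le c(1) unfolding i'_def by auto
  have j': "root_path j' = take (depth j) (root_path j)" "j' \<in> {1..m}" "depth j' = depth j - 1"
    using root_path_ancestor[OF ij(2), of "depth j - 1"] le c(1) unfolding j'_def by auto
  have "c - 1 \<in> common i j"
    using c unfolding common_eq[OF ij] by (simp add: i_def j_def)
  then have "c - 1 \<in> common i' j'"
    unfolding common_def i'(1,3) j'(1,3) using le c(1) by (auto simp: min_def)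
  then have mono: "c - 1 \<le> meet_depth i' j'" unfolding common_eq[OF i'(2) j'(2)] by simp
  have "depth i' + depth j' = e - 2" using i'(3) j'(3) le c(1) e unfolding i_def j_def by simp
  then have "parity_interval (e - 2) (c - 1) \<subseteq> lengths (i', j')" "lengths (i', j') \<subseteq> {..e - 2}"
    using parity_interval_mono[OF mono, of "e - 2"] parity_interval_subset unfolding lengths_def by auto
  moreover have "parity_interval e c - {e} = parity_interval (e - 2) (c - 1)"
    using le c(1) e unfolding i_def j_def by (intro parity_interval_remove_top) auto
  moreover have "e \<notin> {..e - 2}" using le c(1) e unfolding i_def j_def by simp
  ultimately have "lengths (i', j') \<inter> parity_interval e c = parity_interval e c - {e}" by blast
  then show ?thesis using ex_index_pair[OF i'(2) j'(2)] by metis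
qed

section \<open>The poset as a family of sets closed under intersection\<close>

definition meets :: "nat set set" where
  "meets = (\<lambda>S. \<Inter> (lengths ` S)) ` index_sets m"

lemma meetsI: "S \<in> index_sets m \<Longrightarrow> \<Inter> (lengths ` S) \<in> meets"
  unfolding meets_def by (rule imageI)

lemma finite_index_pairs: "finite (index_pairs m)"
  unfolding pair_list(2)[symmetric] by simp

lemma finite_index_sets: "finite (index_sets m)"
  unfolding set_list(2)[symmetric] by simp

lemma index_setsD: "S \<in> index_sets m \<Longrightarrow> finite S \<and> S \<noteq> {} \<and> S \<subseteq> index_pairs m"
  using finite_index_pairs finite_subset unfolding index_sets_def by auto

text \<open>Induction on \<open>S\<close>: the intersection of two progressions keeps the top of one
  of them. The witness \<open>a\<close> and the bound on \<open>c\<close> are carried along because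
  \<open>lengths_of_parents\<close> requires them.\<close>

lemma meet_lengths:
  assumes "S \<in> index_sets m"
  shows "\<Inter> (lengths ` S) = {} \<or>
    (\<exists>a \<in> S. \<exists>c \<le> meet_depth (fst a) (snd a).
      \<Inter> (lengths ` S) = parity_interval (depth (fst a) + depth (snd a)) c)"
proof -
  have "finite S" "S \<noteq> {}" "S \<subseteq> index_pairs m" using index_setsD assms by auto
  then show ?thesis
  proof (induction S rule: finite_ne_induct)
    case (singleton a)
    then show ?case unfolding lengths_def by auto
  next
    case (insert a S)
    have le: "2 * meet_depth (fst b) (snd b) \<le> depth (fst b) + depth (snd b)"
      if "b \<in> insert a S" for b
      using that insert.prems index_pairsD[of "fst b" "snd b"] by (intro meet_depth_double_le) auto
    have eq: "\<Inter> (lengths ` insert a S) = lengths a \<inter> \<Inter> (lengths ` S)" by simp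
    consider "\<Inter> (lengths ` S) = {}" | b c where "b \<in> S" "c \<le> meet_depth (fst b) (snd b)"
      "\<Inter> (lengths ` S) = parity_interval (depth (fst b) + depth (snd b)) c"
      using insert.IH insert.prems by blast
    then show ?case
    proof cases
      case 1
      then show ?thesis unfolding eq by simp
    next
      case 2
      have "2 * c \<le> depth (fst b) + depth (snd b)" using le[of b] 2 by simp
      from parity_interval_inter[OF le[of a] this] consider
          "\<Inter> (lengths ` insert a S) = {}"
        | d where "d \<le> meet_depth (fst a) (snd a)"
          "\<Inter> (lengths ` insert a S) = parity_interval (depth (fst a) + depth (snd a)) d"
        | d where "d \<le> c"
          "\<Inter> (lengths ` insert a S) = parity_interval (depth (fst b) + depth (snd b)) d"
        unfolding eq 2(3) lengths_def[of a] by auto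
      then show ?thesis
      proof cases
        case 1
        then show ?thesis by simp
      next
        case 2
        then show ?thesis by (intro disjI2 bexI[of _ a]) auto
      next
        case (3 d)
        then have "d \<le> meet_depth (fst b) (snd b)" using 2(2) by simp
        then show ?thesis using 3(2) 2(1) by (intro disjI2 bexI[of _ b]) auto
      qed
    qed
  qed
qed

lemma meets_cases:
  assumes "s \<in> meets"
  obtains "s = {}" | S a c where "S \<in> index_sets m" "s = \<Inter> (lengths ` S)" "a \<in> S"
    "c \<le> meet_depth (fst a) (snd a)" "s = parity_interval (depth (fst a) + depth (snd a)) c"
proof -
  obtain S where S: "S \<in> index_sets m" "s = \<Inter> (lengths ` S)"
    using assms unfolding meets_def by blast
  show thesis
    using meet_lengths[OF S(1), folded S(2)] S that by blast
qed

lemma index_setsI: "a \<in> index_pairs m \<Longrightarrow> {a} \<in> index_sets m"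
  unfolding index_sets_def by simp

lemma index_sets_Un: "S \<in> index_sets m \<Longrightarrow> T \<in> index_sets m \<Longrightarrow> S \<union> T \<in> index_sets m"
  unfolding index_sets_def by simp

lemma finite_meets: "finite meets"
  unfolding meets_def using finite_index_sets by simp

lemma meets_subset:
  assumes "s \<in> meets"
  shows "s \<subseteq> {..max_trek_length m E}"
proof -
  obtain S where S: "S \<in> index_sets m" "s = \<Inter> (lengths ` S)"
    using assms unfolding meets_def by blast
  then obtain a where "a \<in> S" "a \<in> index_pairs m" using index_setsD by blast
  then show ?thesis using lengths_subset[of a] S(2) by blast
qed

lemma meets_inter:
  assumes "s \<in> meets" "t \<in> meets"
  shows "s \<inter> t \<in> meets"
proof -
  obtain S T where "S \<in> index_sets m" "T \<in> index_sets m" "s = \<Inter> (lengths ` S)" "t = \<Inter> (lengths ` T)"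
    using assms unfolding meets_def by auto
  then have "S \<union> T \<in> index_sets m" "s \<inter> t = \<Inter> (lengths ` (S \<union> T))"
    using index_sets_Un by auto
  then show ?thesis using meetsI by simp
qed

lemma lengths_in_meets: "a \<in> index_pairs m \<Longrightarrow> lengths a \<in> meets"
  using meetsI[OF index_setsI] by simp

text \<open>Intersect \<open>s\<close> with the set of trek lengths between the parents of a pair
  that has the same top. Two elements in \<open>s\<close> mean \<open>c > 0\<close>, so the parents
  exist.\<close>

lemma meets_remove_Max:
  assumes "s \<in> meets" "2 \<le> card s"
  shows "s - {Max s} \<in> meets"
  using assms(1)
proof (cases rule: meets_cases)
  case 1
  then show ?thesis using assms(2) by simp
next
  case (2 S a c)
  have "c \<noteq> 0"
  proof
    assume "c = 0"
    then have "card s = 1" unfolding 2(5) parity_interval_def by simp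
    then show False using assms(2) by simp
  qed
  moreover have "a \<in> index_pairs m" using 2 index_setsD by blast
  ultimately obtain b where "b \<in> index_pairs m" "lengths b \<inter> s = s - {Max s}"
    using lengths_of_parents[of a c] 2 Max_parity_interval by (metis bot_nat_0.not_eq_extremum)
  then show ?thesis using meets_inter[OF lengths_in_meets assms(1)] by metis
qed

text \<open>Nonempty members are progressions of step 2, and two of these with the same top differ
  only in how far down they reach.\<close>

lemma meets_chain:
  assumes "s \<in> meets" "t \<in> meets" "s \<noteq> {}" "t \<noteq> {}" "Max s = Max t"
  shows "s \<subseteq> t \<or> t \<subseteq> s"
proof -
  obtain e c where s: "s = parity_interval e c" using assms(1,3) meets_cases by metis
  obtain e' c' where t: "t = parity_interval e' c'" using assms(2,4) meets_cases by metis
  have "e = e'" using assms(5) unfolding s t Max_parity_interval .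
  then show ?thesis unfolding s t using parity_interval_mono by (metis nat_le_linear)
qed

end

section \<open>Indicator vectors and the relation locus\<close>

definition ind_vec :: "nat \<Rightarrow> nat set \<Rightarrow> int vec" where
  "ind_vec n s = vec n (\<lambda>k. if k \<in> s then 1 else 0)"

lemma dim_ind_vec [simp]: "dim_vec (ind_vec n s) = n"
  unfolding ind_vec_def by simp

lemma ind_vec_carrier [simp]: "ind_vec n s \<in> carrier_vec n"
  unfolding ind_vec_def by simp

lemma ind_vec_index: "k < n \<Longrightarrow> ind_vec n s $ k = (if k \<in> s then 1 else 0)"
  unfolding ind_vec_def by simp

lemma ind_vec_le_iff: "s \<subseteq> {..<n} \<Longrightarrow> ind_vec n s \<le> ind_vec n t \<longleftrightarrow> s \<subseteq> t"
  unfolding less_eq_vec_def by (auto simp: ind_vec_index split: if_splits)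

lemma ind_vec_eq_iff:
  "s \<subseteq> {..<n} \<Longrightarrow> t \<subseteq> {..<n} \<Longrightarrow> ind_vec n s = ind_vec n t \<longleftrightarrow> s = t"
  using ind_vec_le_iff[of s n t] ind_vec_le_iff[of t n s] by auto

lemma ind_vec_less_iff:
  "s \<subseteq> {..<n} \<Longrightarrow> t \<subseteq> {..<n} \<Longrightarrow> ind_vec n s < ind_vec n t \<longleftrightarrow> s \<subset> t"
  using ind_vec_le_iff[of s n t] ind_vec_le_iff[of t n s] unfolding less_vec_def by auto

lemma vec_Min_ind_vec:
  assumes "finite A" "A \<noteq> {}"
  shows "vec_Min n (ind_vec n ` A) = ind_vec n (\<Inter> A)"
proof (rule eq_vecI)
  fix k assume "k < dim_vec (ind_vec n (\<Inter> A))"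
  then have k: "k < n" by simp
  have eq: "(\<lambda>v. v $ k) ` ind_vec n ` A = (\<lambda>s. if k \<in> s then 1 else 0) ` A"
    unfolding image_image using k by (simp add: ind_vec_index)
  have "Min ((\<lambda>s. if k \<in> s then 1 else 0 :: int) ` A) = (if k \<in> \<Inter> A then 1 else 0)"
    using assms by (intro Min_eqI) (auto split: if_splits)
  then show "vec_Min n (ind_vec n ` A) $ k = ind_vec n (\<Inter> A) $ k"
    using k unfolding vec_Min_def eq[symmetric] by (simp add: ind_vec_index)
qed (simp add: vec_Min_def)

lemma vec_Max_ind_vec:
  assumes "finite A"
  shows "vec_Max n (ind_vec n ` A) = ind_vec n (\<Union> A)"
proof (cases "A = {}")
  case True
  \<comment> \<open>The empty join is set to the zero vector, which is the indicator vector of the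
    empty union.\<close>
  then show ?thesis unfolding vec_Max_def ind_vec_def by (auto simp: zero_vec_def)
next
  case False
  show ?thesis
  proof (rule eq_vecI)
    fix k assume "k < dim_vec (ind_vec n (\<Union> A))"
    then have k: "k < n" by simp
    have eq: "(\<lambda>v. v $ k) ` ind_vec n ` A = (\<lambda>s. if k \<in> s then 1 else 0) ` A"
      unfolding image_image using k by (simp add: ind_vec_index)
    have "Max ((\<lambda>s. if k \<in> s then 1 else 0 :: int) ` A) = (if k \<in> \<Union> A then 1 else 0)"
      using assms False by (intro Max_eqI) (auto split: if_splits)
    then show "vec_Max n (ind_vec n ` A) $ k = ind_vec n (\<Union> A) $ k"
      using k False unfolding vec_Max_def eq[symmetric] by (simp add: ind_vec_index)
  qed (use False in \<open>simp add: vec_Max_def\<close>)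
qed

lemma ind_vec_scalar_prod:
  fixes x :: "real vec"
  assumes "s \<subseteq> {..<n}" "x \<in> carrier_vec n"
  shows "map_vec of_int (ind_vec n s) \<bullet> x = (\<Sum>k\<in>s. x $ k)"
proof -
  have "map_vec of_int (ind_vec n s) \<bullet> x = (\<Sum>k<n. if k \<in> s then x $ k else 0)"
    using assms(2) unfolding scalar_prod_def lessThan_atLeast0
    by (intro sum.cong) (auto simp: ind_vec_index)
  also have "\<dots> = (\<Sum>k\<in>{..<n} \<inter> s. x $ k)" by (simp add: sum.If_cases)
  also have "{..<n} \<inter> s = s" using assms(1) by blast
  finally show ?thesis .
qed

lemma unit_vec_eq_ind_vec: "unit_vec n k = map_vec of_int (ind_vec n {k})"
  by (rule eq_vecI) (auto simp: ind_vec_index unit_vec_def)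

section \<open>Coordinates, polynomial functions and the number of pairs\<close>

lemma polynomial_functions_diff:
  assumes "p \<in> polynomial_functions n" "q \<in> polynomial_functions n"
  shows "(\<lambda>x. p x - q x) \<in> polynomial_functions n"
proof -
  have "(\<lambda>x. p x + (-1) * q x) \<in> polynomial_functions n"
    by (intro polynomial_functions.intros assms)
  then show ?thesis by simp
qed

lemma coord_nth: "i < length (set_list m) \<Longrightarrow> coord m z (set_list m ! i) = z $ i"
  unfolding coord_def
  using nth_eq_iff_index_eq[OF set_list(1)[of m]]
  by (intro arg_cong[of _ _ "\<lambda>a. z $ a"] the_equality) auto

lemma index_sets_nth:
  assumes "S \<in> index_sets m"
  obtains i where "i < length (set_list m)" "set_list m ! i = S"
  using assms unfolding set_list(2)[symmetric] in_set_conv_nth by blast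

lemma coord_polynomial:
  "S \<in> index_sets m \<Longrightarrow> (\<lambda>z. coord m z S) \<in> polynomial_functions (length (set_list m))"
  by (erule index_sets_nth) (use coord_nth polynomial_functions.coordinate in fastforce)

lemma relation_locusD:
  assumes z: "z \<in> relation_locus m E"
  shows "z \<in> carrier_vec (length (set_list m))"
    and "\<And>S S'. S \<in> index_sets m \<Longrightarrow> S' \<in> index_sets m \<Longrightarrow>
      trek_meet m E S = trek_meet m E S' \<Longrightarrow> coord m z S - coord m z S' = 0"
    and "\<And>S S1 S2 S3. S \<in> index_sets m \<Longrightarrow> S1 \<in> index_sets m \<Longrightarrow> S2 \<in> index_sets m \<Longrightarrow>
      S3 \<in> index_sets m \<Longrightarrow>
      residue_vec m E (trek_meet m E S) = 0\<^sub>v (max_trek_length m E + 1) \<Longrightarrow>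
      lower_cover m E (trek_meet m E S) = {trek_meet m E S1, trek_meet m E S2} \<Longrightarrow>
      vec_Min (max_trek_length m E + 1) {trek_meet m E S1, trek_meet m E S2} = trek_meet m E S3 \<Longrightarrow>
      coord m z S - coord m z S1 - coord m z S2 + coord m z S3 = 0"
    and "\<And>S. S \<in> index_sets m \<Longrightarrow> trek_meet m E S = 0\<^sub>v (max_trek_length m E + 1) \<Longrightarrow>
      coord m z S = 0"
proof -
  note D = z[unfolded relation_locus_def mem_Collect_eq]
  show "z \<in> carrier_vec (length (set_list m))"
    using D by (rule conjunct1)
  show "coord m z S - coord m z S' = 0"
    if "S \<in> index_sets m" "S' \<in> index_sets m" "trek_meet m E S = trek_meet m E S'" for S S'
    using D[THEN conjunct2, THEN conjunct1, rule_format, OF that] .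
  show "coord m z S - coord m z S1 - coord m z S2 + coord m z S3 = 0"
    if "S \<in> index_sets m" "S1 \<in> index_sets m" "S2 \<in> index_sets m" "S3 \<in> index_sets m"
      "residue_vec m E (trek_meet m E S) = 0\<^sub>v (max_trek_length m E + 1)"
      "lower_cover m E (trek_meet m E S) = {trek_meet m E S1, trek_meet m E S2}"
      "vec_Min (max_trek_length m E + 1) {trek_meet m E S1, trek_meet m E S2} = trek_meet m E S3"
    for S S1 S2 S3
    using D[THEN conjunct2, THEN conjunct2, THEN conjunct1, rule_format,
        OF that(1-4) conjI[OF that(5) conjI[OF that(6,7)]]] .
  show "coord m z S = 0"
    if "S \<in> index_sets m" "trek_meet m E S = 0\<^sub>v (max_trek_length m E + 1)" for S
    using D[THEN conjunct2, THEN conjunct2, THEN conjunct2, rule_format, OF that] .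
qed

lemma zariski_closureD:
  "z \<in> zariski_closure n X \<Longrightarrow> p \<in> polynomial_functions n \<Longrightarrow> (\<And>x. x \<in> X \<Longrightarrow> p x = 0) \<Longrightarrow> p z = 0"
  unfolding zariski_closure_def by blast

lemma card_index_pairs: "card (index_pairs m) = (m + 1) choose 2"
proof (induction m)
  case 0
  have "index_pairs 0 = {}" unfolding index_pairs_def by auto
  then show ?case by simp
next
  case (Suc m)
  have "index_pairs (Suc m) = index_pairs m \<union> (\<lambda>i. (i, Suc m)) ` {1..Suc m}"
    unfolding index_pairs_def by (auto simp: le_Suc_eq)
  moreover have "finite (index_pairs m)" unfolding pair_list(2)[symmetric] by simp
  then have "card (index_pairs m \<union> (\<lambda>i. (i, Suc m)) ` {1..Suc m}) =
      card (index_pairs m) + card ((\<lambda>i. (i, Suc m)) ` {1..Suc m})"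
    by (intro card_Un_disjoint) (auto simp: index_pairs_def)
  moreover have "card ((\<lambda>i. (i, Suc m)) ` {1..Suc m}) = Suc m"
    by (subst card_image) (auto simp: inj_on_def)
  ultimately show ?case using Suc.IH by (simp add: numeral_2_eq_2)
qed

lemma length_pair_list: "length (pair_list m) = (m + 1) choose 2"
  using distinct_card[OF pair_list(1)[of m]] card_index_pairs[of m] pair_list(2)[of m] by simp

section \<open>The poset and the matrices in terms of sets\<close>

context dtree
begin

text \<open>The number of coefficients of a trek polynomial, thus one more than the length of the
  longest trek.\<close>

abbreviation N :: nat where "N \<equiv> max_trek_length m E + 1"

lemma trek_vec_eq:
  assumes "a \<in> index_pairs m"
  shows "trek_vec m E a = ind_vec N (lengths a)"
proof -
  obtain i j where a: "a = (i, j)" by fastforce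
  then show ?thesis
    using card_treks index_pairsD[of i j] assms
    unfolding trek_vec_def ind_vec_def by (auto intro!: eq_vecI)
qed

lemma trek_meet_eq:
  assumes "S \<in> index_sets m"
  shows "trek_meet m E S = ind_vec N (\<Inter> (lengths ` S))"
proof -
  have S: "finite S" "S \<noteq> {}" "S \<subseteq> index_pairs m" using index_setsD assms by auto
  then have "trek_vec m E ` S = ind_vec N ` lengths ` S"
    unfolding image_image using trek_vec_eq by (intro image_cong) auto
  then show ?thesis
    unfolding trek_meet_def using vec_Min_ind_vec[of "lengths ` S" N] S by simp
qed

lemma meets_lessThan: "s \<in> meets \<Longrightarrow> s \<subseteq> {..<N}"
  using meets_subset by (simp add: lessThan_Suc_atMost)

lemma trek_poset_eq: "trek_poset m E = ind_vec N ` meets"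
  unfolding trek_poset_def meets_def image_image using trek_meet_eq by (intro image_cong) auto

lemma below_eq:
  assumes "s \<in> meets"
  shows "{s' \<in> trek_poset m E. s' < ind_vec N s} = ind_vec N ` {v \<in> meets. v \<subset> s}"
  unfolding trek_poset_eq using ind_vec_less_iff[OF meets_lessThan meets_lessThan] assms by auto

text \<open>The join of indicator vectors is the indicator vector of the union, so the residue marks
  the elements of \<open>s\<close> outside all smaller members.\<close>

lemma residue_vec_eq_0_iff:
  assumes "s \<in> meets"
  shows "residue_vec m E (ind_vec N s) = 0\<^sub>v N \<longleftrightarrow> \<Union> {v \<in> meets. v \<subset> s} = s"
proof -
  have sub: "\<Union> {v \<in> meets. v \<subset> s} \<subseteq> {..<N}" using meets_lessThan by blast
  have "residue_vec m E (ind_vec N s) = ind_vec N s - ind_vec N (\<Union> {v \<in> meets. v \<subset> s})"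
    unfolding residue_vec_def below_eq[OF assms] using finite_meets by (subst vec_Max_ind_vec) auto
  also have "\<dots> = 0\<^sub>v N \<longleftrightarrow> ind_vec N s = ind_vec N (\<Union> {v \<in> meets. v \<subset> s})"
    by (auto simp: vec_eq_iff)
  finally show ?thesis using ind_vec_eq_iff[OF meets_lessThan[OF assms] sub] by blast
qed

lemma lower_cover_eq:
  assumes "s \<in> meets"
  shows "lower_cover m E (ind_vec N s) =
    ind_vec N ` {v \<in> meets. v \<subset> s \<and> \<not> (\<exists>w \<in> meets. v \<subset> w \<and> w \<subset> s)}"
proof -
  have "ind_vec N u < ind_vec N v \<longleftrightarrow> u \<subset> v" if "u \<in> meets" "v \<in> meets" for u v
    using ind_vec_less_iff[OF meets_lessThan meets_lessThan] that by blast
  then show ?thesis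
    unfolding lower_cover_def trek_poset_eq using assms by auto
qed

lemma vec_Min_pair: "vec_Min N {ind_vec N t, ind_vec N u} = ind_vec N (t \<inter> u)"
  using vec_Min_ind_vec[of "{t, u}" N] by simp

lemma M_phi_hat_carrier: "M_phi_hat m E \<in> carrier_mat (length (set_list m)) N"
  unfolding M_phi_hat_def by auto

lemma M_phi_carrier: "M_phi m E \<in> carrier_mat (length (pair_list m)) N"
  unfolding M_phi_def by auto

lemma row_M_phi:
  assumes "i < length (pair_list m)"
  shows "row (M_phi m E) i = map_vec of_int (ind_vec N (lengths (pair_list m ! i)))"
proof -
  have "pair_list m ! i \<in> index_pairs m"
    unfolding pair_list(2)[symmetric] using assms by simp
  then show ?thesis
    using assms trek_vec_eq unfolding M_phi_def by (subst mat_of_rows_row) auto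
qed

lemma row_M_phi_hat:
  assumes "i < length (set_list m)"
  shows "row (M_phi_hat m E) i = map_vec of_int (ind_vec N (\<Inter> (lengths ` (set_list m ! i))))"
proof -
  have "set_list m ! i \<in> index_sets m"
    unfolding set_list(2)[symmetric] using assms by simp
  then show ?thesis
    using assms trek_meet_eq unfolding M_phi_hat_def by (subst mat_of_rows_row) auto
qed

text \<open>Identifies points in the image of the matrix with additive functions on
  \<open>meets\<close>, the form in which \<open>modular_imp_sum\<close> delivers its
  result.\<close>

lemma coord_M_phi_hat:
  assumes "S \<in> index_sets m" "x \<in> carrier_vec N"
  shows "coord m (M_phi_hat m E *\<^sub>v x) S = (\<Sum>k\<in>\<Inter> (lengths ` S). x $ k)"
proof -
  obtain i where i: "i < length (set_list m)" "set_list m ! i = S"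
    using index_sets_nth[OF assms(1)] .
  have "coord m (M_phi_hat m E *\<^sub>v x) S = row (M_phi_hat m E) i \<bullet> x"
    using coord_nth[OF i(1)] i M_phi_hat_carrier by auto
  also have "\<dots> = (\<Sum>k\<in>\<Inter> (lengths ` S). x $ k)"
    unfolding row_M_phi_hat[OF i(1)] i(2)
    using meets_lessThan[OF meetsI[OF assms(1)]] assms(2) by (rule ind_vec_scalar_prod)
  finally show ?thesis .
qed

section \<open>The relation locus as the image of the matrix\<close>

lemma eq_union_of_lower_cover:
  assumes "s \<in> meets" and union: "\<Union> {v \<in> meets. v \<subset> s} = s"
    and cover: "{v \<in> meets. v \<subset> s \<and> \<not> (\<exists>w \<in> meets. v \<subset> w \<and> w \<subset> s)} = {t, u}"
  shows "s = t \<union> u"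
proof
  have "v \<subseteq> t \<or> v \<subseteq> u" if v: "v \<in> meets" "v \<subset> s" for v
  proof -
    \<comment> \<open>By finiteness, \<open>v\<close> lies below a maximal proper member of
      \<open>s\<close>, which belongs to the lower cover.\<close>
    let ?A = "{w \<in> meets. v \<subseteq> w \<and> w \<subset> s}"
    have "finite ?A" "?A \<noteq> {}" using finite_meets v by auto
    from finite_has_maximal[OF this]
    obtain w where w: "w \<in> ?A" "\<forall>w' \<in> ?A. w \<subseteq> w' \<longrightarrow> w = w'" by (rule bexE)
    have "\<not> (\<exists>w' \<in> meets. w \<subset> w' \<and> w' \<subset> s)"
    proof
      assume "\<exists>w' \<in> meets. w \<subset> w' \<and> w' \<subset> s"
      then obtain w' where "w' \<in> meets" "w \<subset> w'" "w' \<subset> s" by blast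
      then show False using bspec[OF w(2), of w'] w(1) by auto
    qed
    then have "w \<in> {t, u}" unfolding cover[symmetric] using w(1) by blast
    then show ?thesis using w(1) by auto
  qed
  then show "s \<subseteq> t \<union> u" by (subst union[symmetric]) blast
  have "t \<subset> s" "u \<subset> s" using cover by blast+
  then show "t \<union> u \<subseteq> s" by blast
qed

text \<open>Additive functions satisfy inclusion-exclusion: zero residue makes \<open>s\<close> the
  union of its two lower covers, and relation (b) is the formula for the sum over a union.\<close>

lemma image_subset_relation_locus:
  assumes x: "x \<in> carrier_vec N"
  shows "M_phi_hat m E *\<^sub>v x \<in> relation_locus m E"
proof -
  let ?z = "M_phi_hat m E *\<^sub>v x"
  let ?P = "\<lambda>S. \<Inter> (lengths ` S)"
  have inj: "ind_vec N s = ind_vec N t \<longleftrightarrow> s = t" if "s \<in> meets" "t \<in> meets" for s t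
    using ind_vec_eq_iff meets_lessThan that by blast
  have 1: "coord m ?z S - coord m ?z S' = 0"
    if "S \<in> index_sets m" "S' \<in> index_sets m" "trek_meet m E S = trek_meet m E S'" for S S'
    using that inj[OF meetsI meetsI, of S S'] trek_meet_eq coord_M_phi_hat[OF _ x] by simp
  have 2: "coord m ?z S - coord m ?z S1 - coord m ?z S2 + coord m ?z S3 = 0"
    if S: "S \<in> index_sets m" "S1 \<in> index_sets m" "S2 \<in> index_sets m" "S3 \<in> index_sets m"
      and res: "residue_vec m E (trek_meet m E S) = 0\<^sub>v N"
      and cover: "lower_cover m E (trek_meet m E S) = {trek_meet m E S1, trek_meet m E S2}"
      and Min: "vec_Min N {trek_meet m E S1, trek_meet m E S2} = trek_meet m E S3" for S S1 S2 S3
  proof -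
    note P = S[THEN meetsI]
    let ?C = "{v \<in> meets. v \<subset> ?P S \<and> \<not> (\<exists>w \<in> meets. v \<subset> w \<and> w \<subset> ?P S)}"
    have image: "ind_vec N ` ?C = ind_vec N ` {?P S1, ?P S2}"
      using cover unfolding trek_meet_eq[OF S(1)] trek_meet_eq[OF S(2)] trek_meet_eq[OF S(3)]
        lower_cover_eq[OF P(1)] by simp
    have inj_on: "inj_on (ind_vec N) meets" using inj by (auto intro: inj_onI)
    have sub: "?C \<subseteq> meets" "{?P S1, ?P S2} \<subseteq> meets" using P by (simp_all add: Collect_restrict)
    \<comment> \<open>Injectivity of \<open>ind_vec N\<close> on \<open>meets\<close> carries the
      lower cover from vectors back to sets.\<close>
    have C: "?C = {?P S1, ?P S2}"
      using inj_on_image_eq_iff[OF inj_on sub] image by (rule iffD1)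
    have "\<Union> {v \<in> meets. v \<subset> ?P S} = ?P S"
      using res unfolding trek_meet_eq[OF S(1)] residue_vec_eq_0_iff[OF P(1)] .
    then have un: "?P S = ?P S1 \<union> ?P S2" using eq_union_of_lower_cover[OF P(1) _ C] by blast
    have int: "?P S3 = ?P S1 \<inter> ?P S2"
      using Min unfolding trek_meet_eq[OF S(2)] trek_meet_eq[OF S(3)] trek_meet_eq[OF S(4)]
        vec_Min_pair inj[OF meets_inter[OF P(2,3)] P(4)] by (rule sym)
    have "finite (?P S1)" "finite (?P S2)"
      using P(2,3) meets_lessThan finite_subset by blast+
    then have "(\<Sum>k\<in>?P S. x $ k) =
        (\<Sum>k\<in>?P S1. x $ k) + (\<Sum>k\<in>?P S2. x $ k) - (\<Sum>k\<in>?P S3. x $ k)"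
      unfolding un int by (rule sum_Un)
    then show ?thesis using S by (simp add: coord_M_phi_hat[OF _ x])
  qed
  have 3: "coord m ?z S = 0" if S: "S \<in> index_sets m" "trek_meet m E S = 0\<^sub>v N" for S
  proof -
    have "ind_vec N (?P S) = ind_vec N {}"
      using S trek_meet_eq by (auto simp: ind_vec_def zero_vec_def)
    then have "?P S = {}"
      using ind_vec_eq_iff[OF meets_lessThan[OF meetsI[OF S(1)]], of "{}"] by blast
    then have "(\<Sum>k\<in>?P S. x $ k) = 0" by simp
    then show ?thesis using coord_M_phi_hat[OF S(1) x] by simp
  qed
  have "?z \<in> carrier_vec (length (set_list m))"
    using M_phi_hat_carrier x by simp
  then show ?thesis unfolding relation_locus_def using 1 2 3 by blast
qed

text \<open>Relation (a) makes \<open>z\<close> a function \<open>f\<close> on \<open>meets\<close>;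
  relation (b) and the vanishing at the zero vector are the hypotheses \<open>f_cover\<close> and
  \<open>f_empty\<close> of \<open>modular_imp_sum\<close>. The resulting \<open>x\<close> is the
  preimage.\<close>

lemma relation_locus_subset_image:
  assumes z: "z \<in> relation_locus m E"
  shows "\<exists>x \<in> carrier_vec N. z = M_phi_hat m E *\<^sub>v x"
proof -
  let ?P = "\<lambda>S. \<Inter> (lengths ` S)"
  define f where "f s = coord m z (SOME S. S \<in> index_sets m \<and> ?P S = s)" for s
  have f: "f (?P S) = coord m z S" if S: "S \<in> index_sets m" for S
  proof -
    define S' where "S' = (SOME S'. S' \<in> index_sets m \<and> ?P S' = ?P S)"
    have S': "S' \<in> index_sets m \<and> ?P S' = ?P S"
      unfolding S'_def by (rule someI[of _ S]) (use S in simp)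
    then have "trek_meet m E S' = trek_meet m E S" using trek_meet_eq S by simp
    from relation_locusD(2)[OF z conjunct1[OF S'] S this]
    show ?thesis unfolding f_def S'_def by (rule eq_iff_diff_eq_0[THEN iffD2])
  qed
  have "\<exists>x. \<forall>s \<in> meets. f s = sum x s"
  proof (rule modular_imp_sum[OF finite_meets _ meets_inter meets_remove_Max meets_chain])
    show "finite s" if "s \<in> meets" for s using meets_lessThan[OF that] finite_subset by blast
    show "f {} = 0" if "{} \<in> meets"
    proof -
      obtain S where S: "S \<in> index_sets m" "?P S = {}" using \<open>{} \<in> meets\<close> unfolding meets_def by blast
      have "trek_meet m E S = 0\<^sub>v N"
        unfolding trek_meet_eq[OF S(1)] S(2) by (auto simp: ind_vec_def zero_vec_def)
      then show ?thesis using relation_locusD(4)[OF z S(1)] f[OF S(1)] S(2) by simp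
    qed
    show "f s = f t + f u - f (t \<inter> u)"
      if mem: "s \<in> meets" "t \<in> meets" "u \<in> meets" and union: "\<Union> {v \<in> meets. v \<subset> s} = s"
        and cover: "{v \<in> meets. v \<subset> s \<and> \<not> (\<exists>w \<in> meets. v \<subset> w \<and> w \<subset> s)} = {t, u}" for s t u
    proof -
      have ex: "\<exists>S \<in> index_sets m. v = ?P S" if "v \<in> meets" for v
        using that unfolding meets_def by blast
      obtain S S1 S2 S3 where S: "S \<in> index_sets m" "S1 \<in> index_sets m" "S2 \<in> index_sets m"
          "S3 \<in> index_sets m"
        and P: "s = ?P S" "t = ?P S1" "u = ?P S2" "t \<inter> u = ?P S3"
        using ex[OF mem(1)] ex[OF mem(2)] ex[OF mem(3)] ex[OF meets_inter[OF mem(2,3)]] by metis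
      have M: "trek_meet m E S = ind_vec N s" "trek_meet m E S1 = ind_vec N t"
        "trek_meet m E S2 = ind_vec N u" "trek_meet m E S3 = ind_vec N (t \<inter> u)"
        using trek_meet_eq S P by simp_all
      have "residue_vec m E (trek_meet m E S) = 0\<^sub>v N"
        unfolding M(1) using residue_vec_eq_0_iff[OF mem(1)] union by blast
      moreover have "lower_cover m E (trek_meet m E S) = {trek_meet m E S1, trek_meet m E S2}"
        unfolding M lower_cover_eq[OF mem(1)] cover by simp
      moreover have "vec_Min N {trek_meet m E S1, trek_meet m E S2} = trek_meet m E S3"
        unfolding M by (rule vec_Min_pair)
      ultimately have "coord m z S - coord m z S1 - coord m z S2 + coord m z S3 = 0"
        by (rule relation_locusD(3)[OF z S])
      then show ?thesis unfolding P(4) unfolding P(1-3) using f S by simp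
    qed
  qed
  then obtain x where x: "\<And>s. s \<in> meets \<Longrightarrow> f s = sum x s" by blast
  have c: "vec N x \<in> carrier_vec N" by simp
  have "z = M_phi_hat m E *\<^sub>v vec N x"
  proof (rule eq_vecI)
    show "dim_vec z = dim_vec (M_phi_hat m E *\<^sub>v vec N x)"
      using relation_locusD(1)[OF z] M_phi_hat_carrier by auto
    fix i assume "i < dim_vec (M_phi_hat m E *\<^sub>v vec N x)"
    then have i: "i < length (set_list m)" using M_phi_hat_carrier by auto
    let ?S = "set_list m ! i"
    have S: "?S \<in> index_sets m" unfolding set_list(2)[symmetric] using i by simp
    have "z $ i = f (?P ?S)" using f[OF S] coord_nth[OF i] by simp
    also have "\<dots> = sum x (?P ?S)" using x[OF meetsI[OF S]] .
    also have "\<dots> = (\<Sum>k\<in>?P ?S. vec N x $ k)"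
      using meets_lessThan[OF meetsI[OF S]] by (intro sum.cong) auto
    also have "\<dots> = (M_phi_hat m E *\<^sub>v vec N x) $ i"
      using coord_M_phi_hat[OF S c] coord_nth[OF i] by simp
    finally show "z $ i = (M_phi_hat m E *\<^sub>v vec N x) $ i" .
  qed
  then show ?thesis using c by blast
qed

lemma relation_locus_eq: "relation_locus m E = (*\<^sub>v) (M_phi_hat m E) ` carrier_vec N"
  using image_subset_relation_locus relation_locus_subset_image by blast

section \<open>Minimality of the relation locus\<close>

lemma subspace_relation_locus:
  "subspace class_ring (relation_locus m E) (module_vec TYPE(real) (length (set_list m)))"
proof (rule subspace_vecI)
  note M = M_phi_hat_carrier
  show "relation_locus m E \<subseteq> carrier_vec (length (set_list m))"
    unfolding relation_locus_def by blast
  show "0\<^sub>v (length (set_list m)) \<in> relation_locus m E"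
    unfolding relation_locus_eq using M by (intro image_eqI[of _ _ "0\<^sub>v N"]) auto
  show "v + w \<in> relation_locus m E" if "v \<in> relation_locus m E" "w \<in> relation_locus m E" for v w
    using that unfolding relation_locus_eq
    by (auto simp: mult_add_distrib_mat_vec[OF M, symmetric])
  show "c \<cdot>\<^sub>v v \<in> relation_locus m E" if "v \<in> relation_locus m E" for c v
    using that unfolding relation_locus_eq by (auto simp: mult_mat_vec[OF M, symmetric])
qed

lemma phi_hat_in_relation_locus: "phi_hat m E p \<in> relation_locus m E"
  unfolding phi_hat_def by (auto split: prod.split intro!: image_subset_relation_locus)

text \<open>Each defining relation is a polynomial function that vanishes on the parametrized
  points, hence on their Zariski closure.\<close>

lemma V_phi_hat_subset_relation_locus: "V_phi_hat m E \<subseteq> relation_locus m E"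
proof
  fix z assume z: "z \<in> V_phi_hat m E"
  have vanish: "p z = 0" if "p \<in> polynomial_functions (length (set_list m))"
    "\<And>x. x \<in> relation_locus m E \<Longrightarrow> p x = 0" for p
    using z that(1) unfolding V_phi_hat_def
    by (rule zariski_closureD) (use that(2) phi_hat_in_relation_locus in blast)
  note poly = polynomial_functions_diff polynomial_functions.add coord_polynomial
  have "z \<in> carrier_vec (length (set_list m))"
    using z unfolding V_phi_hat_def zariski_closure_def by blast
  moreover have "coord m z S - coord m z S' = 0"
    if S: "S \<in> index_sets m" "S' \<in> index_sets m" "trek_meet m E S = trek_meet m E S'" for S S'
  proof (rule vanish)
    show "(\<lambda>z. coord m z S - coord m z S') \<in> polynomial_functions (length (set_list m))"
      using S by (intro poly)
    show "coord m x S - coord m x S' = 0" if "x \<in> relation_locus m E" for x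
      using that S by (rule relation_locusD(2))
  qed
  moreover have "coord m z S - coord m z S1 - coord m z S2 + coord m z S3 = 0"
    if S: "S \<in> index_sets m" "S1 \<in> index_sets m" "S2 \<in> index_sets m" "S3 \<in> index_sets m"
      "residue_vec m E (trek_meet m E S) = 0\<^sub>v N"
      "lower_cover m E (trek_meet m E S) = {trek_meet m E S1, trek_meet m E S2}"
      "vec_Min N {trek_meet m E S1, trek_meet m E S2} = trek_meet m E S3" for S S1 S2 S3
  proof (rule vanish)
    show "(\<lambda>z. coord m z S - coord m z S1 - coord m z S2 + coord m z S3)
        \<in> polynomial_functions (length (set_list m))"
      using S by (intro poly)
    show "coord m x S - coord m x S1 - coord m x S2 + coord m x S3 = 0"
      if "x \<in> relation_locus m E" for x
      using relation_locusD(3)[OF that S] .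
  qed
  moreover have "coord m z S = 0"
    if "S \<in> index_sets m" "trek_meet m E S = 0\<^sub>v N" for S
    using coord_polynomial[OF that(1)] relation_locusD(4)[OF _ that] by (rule vanish)
  ultimately show "z \<in> relation_locus m E" unfolding relation_locus_def by blast
qed

lemma phi_hat_in_V_phi_hat: "phi_hat m E p \<in> V_phi_hat m E"
proof -
  have "phi_hat m E p \<in> carrier_vec (length (set_list m))"
    using phi_hat_in_relation_locus unfolding relation_locus_def by blast
  then show ?thesis unfolding V_phi_hat_def zariski_closure_def by blast
qed

text \<open>The points with \<open>\<omega> = 1\<close> and \<open>\<lambda> = 0, ..., N - 1\<close>
  lie in \<open>W\<close>. They are the columns of \<open>M_phi_hat\<close> times a Vandermonde
  matrix, and by surjectivity of the latter they span the image of \<open>M_phi_hat\<close>.\<close>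

lemma relation_locus_minimal:
  assumes W: "subspace class_ring W (module_vec TYPE(real) (length (set_list m)))"
    and V: "V_phi_hat m E \<subseteq> W"
  shows "relation_locus m E \<subseteq> W"
proof
  let ?A = "mat N N (\<lambda>(k, j). real j ^ k)"
  note M = M_phi_hat_carrier
  have A: "?A \<in> carrier_mat N N" by simp
  fix z assume "z \<in> relation_locus m E"
  then obtain x where x: "x \<in> carrier_vec N" "z = M_phi_hat m E *\<^sub>v x"
    unfolding relation_locus_eq by blast
  obtain y where y: "y \<in> carrier_vec N" "?A *\<^sub>v y = x"
    using vandermonde_surjective[OF x(1)] by blast
  have "col (M_phi_hat m E * ?A) j \<in> W" if j: "j < N" for j
  proof -
    have "col ?A j = vec N (\<lambda>k. 1 * real j ^ k)"
      using j by (intro eq_vecI) auto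
    then have "col (M_phi_hat m E * ?A) j = phi_hat m E (1, real j)"
      unfolding phi_hat_def col_mult2[OF M A j] by simp
    then show ?thesis using phi_hat_in_V_phi_hat V by auto
  qed
  then have "(M_phi_hat m E * ?A) *\<^sub>v y \<in> W"
    using y(1) M A by (intro mult_mat_vec_in_subspace[OF W]) auto
  then show "z \<in> W" unfolding x(2) y(2)[symmetric] using assoc_mult_mat_vec[OF M A y(1)] by simp
qed

lemma minimal_linear_subspace_relation_locus:
  "minimal_linear_subspace (length (set_list m)) (V_phi_hat m E) (relation_locus m E)"
  unfolding minimal_linear_subspace_def
  using subspace_relation_locus V_phi_hat_subset_relation_locus relation_locus_minimal by blast

section \<open>Ranks and the kernel of the transpose\<close>

lemma eq_0_if_sums_0:
  fixes v :: "real vec"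
  assumes v: "v \<in> carrier_vec N"
    and sums: "\<And>a. a \<in> index_pairs m \<Longrightarrow> (\<Sum>k\<in>lengths a. v $ k) = 0"
  shows "v = 0\<^sub>v N"
proof (rule eq_vecI)
  fix k assume "k < dim_vec (0\<^sub>v N)"
  then have k: "k < N" "k \<le> max_trek_length m E" by auto
  \<comment> \<open>The coordinate at \<open>k\<close> is one of the vanishing sums or the
    difference of two of them over nested sets.\<close>
  have "v $ k = 0" using singleton_lengths_diff[OF k(2)]
  proof (elim disjE bexE conjE)
    fix a assume "a \<in> index_pairs m" "lengths a = {k}"
    then show ?thesis using sums[of a] by simp
  next
    fix a b assume ab: "a \<in> index_pairs m" "b \<in> index_pairs m" "lengths b \<subseteq> lengths a"
      "lengths a - lengths b = {k}"
    have "finite (lengths a)" unfolding lengths_def by simp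
    then have "(\<Sum>k\<in>lengths a - lengths b. v $ k) = 0"
      using sums ab(1-3) by (simp add: sum_diff)
    then show ?thesis using ab(4) by simp
  qed
  then show "v $ k = 0\<^sub>v N $ k" using k by simp
qed (use v in simp)

lemma rank_M_phi: "vec_space.rank (length (pair_list m)) (M_phi m E) = N"
proof (rule rank_eq_if_kernel_trivial[OF M_phi_carrier])
  fix v :: "real vec" assume v: "v \<in> carrier_vec N" "M_phi m E *\<^sub>v v = 0\<^sub>v (length (pair_list m))"
  show "v = 0\<^sub>v N"
  proof (rule eq_0_if_sums_0[OF v(1)])
    fix a assume a: "a \<in> index_pairs m"
    then obtain i where i: "i < length (pair_list m)" "pair_list m ! i = a"
      unfolding pair_list(2)[symmetric] in_set_conv_nth by blast
    have "row (M_phi m E) i \<bullet> v = (M_phi m E *\<^sub>v v) $ i"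
      using i M_phi_carrier by auto
    then have "row (M_phi m E) i \<bullet> v = 0" using v(2) i by simp
    then show "(\<Sum>k\<in>lengths a. v $ k) = 0"
      unfolding row_M_phi[OF i(1)] i(2)
      using ind_vec_scalar_prod[OF meets_lessThan[OF lengths_in_meets[OF a]] v(1)] by simp
  qed
qed

text \<open>The singletons \<open>{a}\<close> put all rows of \<open>M_phi\<close> among the rows of
  \<open>M_phi_hat\<close>, so the same sums vanish for a kernel vector.\<close>

lemma rank_M_phi_hat: "vec_space.rank (length (set_list m)) (M_phi_hat m E) = N"
proof (rule rank_eq_if_kernel_trivial[OF M_phi_hat_carrier])
  fix v :: "real vec"
  assume v: "v \<in> carrier_vec N" "M_phi_hat m E *\<^sub>v v = 0\<^sub>v (length (set_list m))"
  show "v = 0\<^sub>v N"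
  proof (rule eq_0_if_sums_0[OF v(1)])
    fix a assume a: "a \<in> index_pairs m"
    obtain i where i: "i < length (set_list m)" "set_list m ! i = {a}"
      using index_sets_nth[OF index_setsI[OF a]] .
    have "coord m (M_phi_hat m E *\<^sub>v v) {a} = 0"
      using coord_nth[OF i(1), of "0\<^sub>v (length (set_list m))"] i v(2) by simp
    then show "(\<Sum>k\<in>lengths a. v $ k) = 0"
      using coord_M_phi_hat[OF index_setsI[OF a] v(1)] by simp
  qed
qed

lemma kernel_dim_M_phi: "kernel_dim (M_phi m E)\<^sup>T + N = length (pair_list m)"
proof (rule kernel_dim_transpose_eq[OF M_phi_carrier])
  fix k assume "k < N"
  then have k: "k \<le> max_trek_length m E" by simp
  have idx: "\<exists>i < length (pair_list m). pair_list m ! i = a" if "a \<in> index_pairs m" for a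
    using that unfolding pair_list(2)[symmetric] in_set_conv_nth by blast
  show "(\<exists>i < length (pair_list m). row (M_phi m E) i = unit_vec N k) \<or>
    (\<exists>i < length (pair_list m). \<exists>j < length (pair_list m).
      row (M_phi m E) i - row (M_phi m E) j = unit_vec N k)"
    using singleton_lengths_diff[OF k]
  proof (elim disjE bexE conjE)
    fix a assume a: "a \<in> index_pairs m" "lengths a = {k}"
    then obtain i where "i < length (pair_list m)" "pair_list m ! i = a" using idx by blast
    then have "row (M_phi m E) i = unit_vec N k"
      using row_M_phi a(2) unit_vec_eq_ind_vec by metis
    then show ?thesis using \<open>i < length (pair_list m)\<close> by blast
  next
    fix a b assume ab: "a \<in> index_pairs m" "b \<in> index_pairs m" "lengths b \<subseteq> lengths a"
      "lengths a - lengths b = {k}"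
    obtain i j where ij: "i < length (pair_list m)" "pair_list m ! i = a"
      "j < length (pair_list m)" "pair_list m ! j = b" using idx ab(1,2) by blast
    \<comment> \<open>Since \<open>lengths b\<close> is contained in \<open>lengths a\<close>, the
      difference of their indicator vectors is the indicator vector of the set difference.\<close>
    have "row (M_phi m E) i - row (M_phi m E) j = unit_vec N k"
      unfolding row_M_phi[OF ij(1)] row_M_phi[OF ij(3)] ij(2,4) ab(4)[symmetric] unit_vec_eq_ind_vec
      using ab(3) by (intro eq_vecI) (auto simp: ind_vec_index)
    then show ?thesis using ij(1,3) by blast
  qed
qed

end

theorem theorem5p1:
  fixes m :: nat and E :: "(nat \<times> nat) set"
  assumes "directed_tree m E"
  shows "minimal_linear_subspace (length (set_list m)) (V_phi_hat m E) (relation_locus m E) \<and>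
    vec_space.rank (dim_row (M_phi m E)) (M_phi m E)
       = vec_space.rank (dim_row (M_phi_hat m E)) (M_phi_hat m E) \<and>
    int (kernel_dim (transpose_mat (M_phi m E)))
       = int ((m + 1) choose 2) - 2 * int (height m E) - 1"
proof -
  interpret dtree m E by unfold_locales (rule assms)
  have "dim_row (M_phi m E) = length (pair_list m)" "dim_row (M_phi_hat m E) = length (set_list m)"
    using M_phi_carrier M_phi_hat_carrier by auto
  \<comment> \<open>The column count is \<open>2 h + 1\<close> for the height \<open>h\<close>. The
    equation is kept additive in the natural numbers and passes to the integers without
    truncation.\<close>
  moreover have "kernel_dim (transpose_mat (M_phi m E)) + (2 * height m E + 1) = (m + 1) choose 2"
    using kernel_dim_M_phi unfolding height_eq max_trek_length_eq length_pair_list .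
  ultimately show ?thesis
    using minimal_linear_subspace_relation_locus rank_M_phi rank_M_phi_hat by simp
qed

end
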